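(* Given any complex Hilbert spaces $\mathcal H,\mathcal Z$, any orthonormal basis $G:=\{g_j\}_{j\in J}$ of $\mathcal H$, and any $\lambda\in\ell^1(J,\mathbb C)$, consider the map $$\mathsf C_{\lambda,G}:\mathcal B(\mathcal B^1(\mathcal H),\mathcal B^1(\mathcal Z))\to\mathcal B^1(\mathcal H\otimes\mathcal Z),\qquad \Phi\mapsto\sum_{j,k\in J}\lambda_j^*\lambda_k|g_j\rangle\langle g_k|\otimes\Phi(|g_j\rangle\langle g_k|).$$ Then: (i) $\mathsf C_{\lambda,G}$ is injective if and only if $\mathcal H$ is separable and $\lambda_j\neq0$ for all $j\in J$. (ii) $\mathsf C_{\lambda,G}$ is surjective if and only if $\mathcal H$ is finite-dimensional and $\lambda_j\neq0$ for all $j\in J$. In particular, if $\dim\mathcal H=\infty$, then there exist positive semi-definite trace-class operators on $\mathcal H\otimes\mathcal Z$ which have empty pre-image under $\mathsf C_{\lambda,G}$, regardless of the chosen $\lambda\in\ell^1(J,\mathbb C)$ and the chosen orthonormal basis $\{g_j\}_{j\in J}$ of $\mathcal H$.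
   Context: Hilbert spaces may be non-separable. $\mathcal B^1(\cdot)$ denotes the trace-class operators with the trace norm $\|\cdot\|_1$, and $\mathcal B(\mathcal B^1(\mathcal H),\mathcal B^1(\mathcal Z))$ the bounded linear maps between these Banach spaces. $\mathcal H\otimes\mathcal Z$ is the Hilbert space tensor product. Inner products are linear in the second argument and $|x\rangle\langle y|$ is the operator $z\mapsto\langle y,z\rangle x$. $\lambda_j^*$ is the complex conjugate of $\lambda_j$. Sums over possibly uncountable index sets are limits of the net of finite partial sums; the map $\mathsf C_{\lambda,G}$ is well defined because $\lambda\in\ell^1(J,\mathbb C)$.
   Formalization: The Hilbert space Z is assumed to be nonzero; for Z = {0} and H ≠ {0} the map C is the bijection {0} → {0} for every λ and H, so the claims as stated fail. *)

theory Defs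
  imports "HOL-Analysis.Analysis" "HOL-Library.Nonpos_Ints"
begin

section \<open>Complex Hilbert spaces\<close>

text \<open>
  A complex Hilbert space, presented on top of its underlying real Hilbert space: norm and
  topology are inherited from \<^class>\<open>real_inner\<close>, whose inner product is required to be the
  real part of the complex one. The complex inner product is linear in the second argument.
  No separability is imposed, and the zero space is allowed.
\<close>

class chilbert_space = real_inner + complete_space +
  fixes scaleC :: "complex \<Rightarrow> 'a \<Rightarrow> 'a"
    and cinner :: "'a \<Rightarrow> 'a \<Rightarrow> complex"
  assumes scaleC_add_right: "scaleC a (x + y) = scaleC a x + scaleC a y"
    and scaleC_add_left: "scaleC (a + b) x = scaleC a x + scaleC b x"
    and scaleC_scaleC: "scaleC a (scaleC b x) = scaleC (a * b) x"
    and scaleC_of_real: "scaleC (complex_of_real r) x = scaleR r x"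
    and cinner_commute: "cinner x y = cnj (cinner y x)"
    and cinner_add_right: "cinner x (y + z) = cinner x y + cinner x z"
    and cinner_scaleC_right: "cinner x (scaleC a y) = a * cinner x y"
    and inner_eq_Re_cinner: "inner x y = Re (cinner x y)"

global_interpretation complex_vector: vector_space "scaleC :: complex \<Rightarrow> 'a::chilbert_space \<Rightarrow> 'a"
  defines cspan = complex_vector.span
proof
  fix x :: 'a
  show "scaleC 1 x = x"
    using scaleC_of_real[of 1 x] by simp
qed (simp_all add: scaleC_add_right scaleC_add_left scaleC_scaleC)

definition cfinite_dim :: "'a::chilbert_space itself \<Rightarrow> bool" where
  "cfinite_dim _ \<longleftrightarrow> (\<exists>B::'a set. finite B \<and> cspan B = UNIV)"

definition orthonormal_basis :: "'j set \<Rightarrow> ('j \<Rightarrow> 'a::chilbert_space) \<Rightarrow> bool" where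
  "orthonormal_basis J g \<longleftrightarrow>
     (\<forall>j\<in>J. \<forall>k\<in>J. cinner (g j) (g k) = (if j = k then 1 else 0)) \<and>
     closure (cspan (g ` J)) = UNIV"


section \<open>Bounded operators and trace-class operators\<close>

definition bounded_clinear :: "('a::chilbert_space \<Rightarrow> 'b::chilbert_space) \<Rightarrow> bool" where
  "bounded_clinear A \<longleftrightarrow> bounded_linear A \<and> (\<forall>c x. A (scaleC c x) = scaleC c (A x))"

definition cadjoint :: "('a::chilbert_space \<Rightarrow> 'b::chilbert_space) \<Rightarrow> 'b \<Rightarrow> 'a" where
  "cadjoint A = (THE B. \<forall>x y. cinner (B y) x = cinner y (A x))"

definition positive_op :: "('a::chilbert_space \<Rightarrow> 'a) \<Rightarrow> bool" where
  "positive_op A \<longleftrightarrow> bounded_clinear A \<and> (\<forall>x. cinner x (A x) \<in> \<real>\<^sub>\<ge>\<^sub>0)"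

text \<open>\<open>|A|\<close>, the unique positive square root of \<open>A\<^sup>* A\<close>.\<close>

definition abs_op :: "('a::chilbert_space \<Rightarrow> 'a) \<Rightarrow> 'a \<Rightarrow> 'a" where
  "abs_op A = (THE P. positive_op P \<and> P \<circ> P = cadjoint A \<circ> A)"

text \<open>
  The trace of the positive operator \<open>|A|\<close> does not depend on the orthonormal basis used to
  compute it (neither its finiteness nor its value), so an arbitrary basis is fixed once and for all.
\<close>

definition some_basis :: "'a::chilbert_space set" where
  "some_basis = (SOME E. orthonormal_basis E (\<lambda>e. e))"

definition trace_class :: "('a::chilbert_space \<Rightarrow> 'a) \<Rightarrow> bool" where
  "trace_class A \<longleftrightarrow> bounded_clinear A \<and> (\<lambda>e. cinner e (abs_op A e)) summable_on some_basis"

definition trace_norm :: "('a::chilbert_space \<Rightarrow> 'a) \<Rightarrow> real" where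
  "trace_norm A = Re (\<Sum>\<^sub>\<infinity>e\<in>some_basis. cinner e (abs_op A e))"

text \<open>
  \<open>T\<close> is the limit, in trace norm, of the net of finite partial sums of the family
  \<open>(A i)\<close> with \<open>i \<in> I\<close>.
\<close>

definition has_trace_norm_sum ::
    "('i \<Rightarrow> 'a::chilbert_space \<Rightarrow> 'a) \<Rightarrow> ('a \<Rightarrow> 'a) \<Rightarrow> 'i set \<Rightarrow> bool" where
  "has_trace_norm_sum A T I \<longleftrightarrow> trace_class T \<and>
     ((\<lambda>F. trace_norm (\<lambda>x. (\<Sum>i\<in>F. A i x) - T x)) \<longlongrightarrow> 0) (finite_subsets_at_top I)"

text \<open>
  The bounded complex-linear maps between the Banach spaces of trace-class operators. Such a map
  is a function on trace-class operators only, hence is taken to be \<^const>\<open>undefined\<close> elsewhere.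
\<close>

definition bounded_trace_class_maps ::
    "(('a::chilbert_space \<Rightarrow> 'a) \<Rightarrow> ('b::chilbert_space \<Rightarrow> 'b)) set" where
  "bounded_trace_class_maps =
     {\<Phi> \<in> Collect trace_class \<rightarrow>\<^sub>E Collect trace_class.
        (\<forall>A B. trace_class A \<longrightarrow> trace_class B \<longrightarrow>
           \<Phi> (\<lambda>x. A x + B x) = (\<lambda>z. \<Phi> A z + \<Phi> B z)) \<and>
        (\<forall>c A. trace_class A \<longrightarrow> \<Phi> (\<lambda>x. scaleC c (A x)) = (\<lambda>z. scaleC c (\<Phi> A z))) \<and>
        (\<exists>K. \<forall>A. trace_class A \<longrightarrow> trace_norm (\<Phi> A) \<le> K * trace_norm A)}"

definition ketbra :: "'a::chilbert_space \<Rightarrow> 'b::chilbert_space \<Rightarrow> 'b \<Rightarrow> 'a" where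
  "ketbra x y = (\<lambda>z. scaleC (cinner y z) x)"


section \<open>Hilbert space tensor products\<close>

text \<open>
  The space \<open>'k\<close> with elementary tensors \<open>tens x y\<close> is a Hilbert space tensor product of
  \<open>'h\<close> and \<open>'z\<close>: the completion of the algebraic tensor product with respect to the inner
  product below. This determines \<open>('k, tens)\<close> up to a unique unitary isomorphism.
\<close>

definition hilbert_tensor ::
    "('h::chilbert_space \<Rightarrow> 'z::chilbert_space \<Rightarrow> 'k::chilbert_space) \<Rightarrow> bool" where
  "hilbert_tensor tens \<longleftrightarrow>
     (\<forall>x x' y. tens (x + x') y = tens x y + tens x' y) \<and>
     (\<forall>x y y'. tens x (y + y') = tens x y + tens x y') \<and>
     (\<forall>c x y. tens (scaleC c x) y = scaleC c (tens x y)) \<and>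
     (\<forall>c x y. tens x (scaleC c y) = scaleC c (tens x y)) \<and>
     (\<forall>x x' y y'. cinner (tens x y) (tens x' y') = cinner x x' * cinner y y') \<and>
     closure (cspan {tens x y | x y. True}) = UNIV"

definition tensor_op ::
    "('h::chilbert_space \<Rightarrow> 'z::chilbert_space \<Rightarrow> 'k::chilbert_space) \<Rightarrow>
     ('h \<Rightarrow> 'h) \<Rightarrow> ('z \<Rightarrow> 'z) \<Rightarrow> 'k \<Rightarrow> 'k" where
  "tensor_op tens A B =
     (THE T. bounded_clinear T \<and> (\<forall>x y. T (tens x y) = tens (A x) (B y)))"


section \<open>The map \<open>C\<^sub>\<lambda>\<^sub>,\<^sub>G\<close>\<close>

text \<open>
  The orthonormal basis is a family \<open>g\<close> over an index set \<open>J :: 'j set\<close>; only the values of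
  \<open>lam\<close> and \<open>g\<close> on \<open>J\<close> matter. Up to reindexing, every orthonormal basis of \<open>'h\<close> already
  occurs for the index type \<open>'h\<close>.
\<close>

definition choi_map ::
    "('h::chilbert_space \<Rightarrow> 'z::chilbert_space \<Rightarrow> 'k::chilbert_space) \<Rightarrow>
     'j set \<Rightarrow> ('j \<Rightarrow> complex) \<Rightarrow> ('j \<Rightarrow> 'h) \<Rightarrow>
     (('h \<Rightarrow> 'h) \<Rightarrow> ('z \<Rightarrow> 'z)) \<Rightarrow> 'k \<Rightarrow> 'k" where
  "choi_map tens J lam g \<Phi> =
     (THE T. has_trace_norm_sum
        (\<lambda>(j, k) v. scaleC (cnj (lam j) * lam k)
                      (tensor_op tens (ketbra (g j) (g k)) (\<Phi> (ketbra (g j) (g k))) v))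
        T (J \<times> J))"

end

theory Submission
  imports Defs
begin

text \<open>
  The trace norm of \<open>A\<close> equals the supremum of \<open>\<Sum>\<^sub>i |\<langle>u\<^sub>i, A v\<^sub>i\<rangle>|\<close> over finite families \<open>u\<close>, \<open>v\<close> that are
  images of orthonormal systems under contractions. This makes the triangle inequality, completeness
  and stability under compressions evident, so that the defining sum of \<open>C\<^sub>\<lambda>\<^sub>,\<^sub>G(\<Phi>)\<close> converges
  absolutely and \<open>\<langle>g\<^sub>j \<otimes> z, C\<^sub>\<lambda>\<^sub>,\<^sub>G(\<Phi>) (g\<^sub>k \<otimes> w)\<rangle> = \<lambda>\<^sub>j\<^sup>* \<lambda>\<^sub>k \<langle>z, \<Phi>(|g\<^sub>j\<rangle>\<langle>g\<^sub>k|) w\<rangle>\<close>. If no \<open>\<lambda>\<^sub>j\<close> vanishes, the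
  right-hand sides determine \<open>\<Phi>\<close>, because the span of the \<open>|g\<^sub>j\<rangle>\<langle>g\<^sub>k|\<close> is dense in trace norm; moreover
  \<open>J\<close> is then countable since \<open>\<lambda>\<close> is summable, so separability is automatic. If \<open>J\<close> is finite, \<open>\<Phi>\<close> can be
  read off from the blocks of a given operator. In infinite dimension the eigenvalues of positive
  operators in the image, compressed to \<open>x \<mapsto> x \<otimes> z\<close>, decay like \<open>n\<^sup>-\<^sup>2\<close>, which a trace-class operator with
  eigenvalues \<open>n\<^sup>-\<^sup>3\<^sup>/\<^sup>2\<close> violates for all choices of \<open>\<lambda>\<close> and \<open>G\<close> at once.
\<close>

text \<open>One operator has to defeat every lambda and every basis G at once, so surjectivity
  cannot be refuted through matrix entries in G; what survives a change of basis is a min-max count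
  of dimensions. Since Phi is not assumed positive, the only control over it is its norm: a finite
  square block of the double sum is a value of Phi at a single rank-one operator |y><y|, and lambda
  enters through the square of norm y, which is where the exponent 2 comes from. Any nonincreasing
  summable sequence of eigenvalues that is not O(n^-2) would serve as a counterexample. The objects
  of the statement are given by \<open>THE\<close> and \<open>SOME\<close>. Absolute values, bases,
  tensor operators and the defining sum must therefore be shown to exist, and under
  \<open>THE\<close> to be unique, before anything can be said about them.\<close>

instance chilbert_space \<subseteq> banach ..

section \<open>Inner products and the Riesz representation\<close>

lemma cinner_add_left: "cinner (x + y) z = cinner x z + cinner y z"
  by (metis cinner_commute cinner_add_right complex_cnj_add)

lemma cinner_scaleC_left: "cinner (scaleC a x) y = cnj a * cinner x y"
  by (metis cinner_commute cinner_scaleC_right complex_cnj_mult)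

lemma cinner_zero_right [simp]: "cinner x 0 = 0"
  using cinner_add_right[of x 0 0] by simp

lemma cinner_zero_left [simp]: "cinner 0 x = 0"
  using cinner_add_left[of 0 0 x] by simp

lemma cinner_minus_right [simp]: "cinner x (- y) = - cinner x y"
  using cinner_add_right[of x y "- y"] by (simp add: add_eq_0_iff2 add.commute)

lemma cinner_minus_left [simp]: "cinner (- x) y = - cinner x y"
  using cinner_add_left[of x "- x" y] by (simp add: add_eq_0_iff2 add.commute)

lemma cinner_diff_right: "cinner x (y - z) = cinner x y - cinner x z"
  using cinner_add_right[of x y "- z"] by simp

lemma cinner_diff_left: "cinner (x - y) z = cinner x z - cinner y z"
  using cinner_add_left[of x "- y" z] by simp

lemma cinner_sum_right: "cinner x (\<Sum>i\<in>I. f i) = (\<Sum>i\<in>I. cinner x (f i))"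
  by (induction I rule: infinite_finite_induct) (auto simp: cinner_add_right)

lemma cinner_sum_left: "cinner (\<Sum>i\<in>I. f i) x = (\<Sum>i\<in>I. cinner (f i) x)"
  by (induction I rule: infinite_finite_induct) (auto simp: cinner_add_left)

lemma cinner_scaleR_right: "cinner x (r *\<^sub>R y) = r *\<^sub>R cinner x y"
  by (metis cinner_scaleC_right scaleC_of_real scaleR_conv_of_real)

lemma cinner_scaleR_left: "cinner (r *\<^sub>R x) y = r *\<^sub>R cinner x y"
  by (metis cinner_scaleC_left scaleC_of_real scaleR_conv_of_real complex_cnj_complex_of_real)

lemma Im_cinner: "Im (cinner x y) = inner (scaleC \<i> x) y"
  by (simp add: inner_eq_Re_cinner cinner_scaleC_left)

lemma cinner_same: "cinner x x = complex_of_real ((norm x)\<^sup>2)"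
proof -
  have "Im (cinner x x) = - Im (cinner x x)"
    by (metis cinner_commute complex_cnj complex.collapse complex.sel(2))
  then have "Im (cinner x x) = 0" by simp
  moreover have "Re (cinner x x) = (norm x)\<^sup>2"
    by (simp add: power2_norm_eq_inner inner_eq_Re_cinner)
  ultimately show ?thesis by (simp add: complex_eq_iff)
qed

lemma cinner_same_eq_0 [simp]: "cinner x x = 0 \<longleftrightarrow> x = 0"
  by (simp add: cinner_same)

lemma norm_scaleC [simp]: "norm (scaleC a x) = cmod a * norm x"
proof -
  have "complex_of_real ((norm (scaleC a x))\<^sup>2) = complex_of_real ((cmod a * norm x)\<^sup>2)"
    unfolding cinner_same[symmetric] cinner_scaleC_left cinner_scaleC_right
    by (simp add: cinner_same power_mult_distrib complex_norm_square[symmetric] mult.assoc[symmetric] mult.commute[of a])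
  then have "(norm (scaleC a x))\<^sup>2 = (cmod a * norm x)\<^sup>2"
    by (simp only: of_real_eq_iff)
  then show ?thesis by (simp add: power2_eq_iff_nonneg)
qed

lemma cmod_cinner_le: "cmod (cinner x y) \<le> norm x * norm y"
proof (cases "cinner x y = 0")
  case False
  define a where "a = cnj (cinner x y) / cmod (cinner x y)"
  have a: "cmod a = 1" using False by (simp add: a_def norm_divide)
  have "a * cinner x y = cmod (cinner x y)"
    using False by (simp add: a_def complex_norm_square[symmetric] mult.commute power2_eq_square)
  then have "cmod (cinner x y) = inner x (scaleC a y)"
    by (simp add: inner_eq_Re_cinner cinner_scaleC_right)
  also have "\<dots> \<le> norm x * norm (scaleC a y)" by (rule norm_cauchy_schwarz)
  finally show ?thesis using a by simp
qed auto

lemma cinner_extI: "x = y" if "\<And>z. cinner z x = cinner z y"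
  using that[of "x - y"] cinner_same_eq_0[of "x - y"] by (simp only: cinner_diff_right) simp

lemma bounded_bilinear_cinner [bounded_bilinear]: "bounded_bilinear cinner"
proof
  show "\<exists>K. \<forall>a b. norm (cinner a b) \<le> norm a * norm b * K"
    by (intro exI[of _ 1]) (simp add: cmod_cinner_le)
qed (simp_all add: cinner_add_left cinner_add_right cinner_scaleR_left cinner_scaleR_right)

lemma bounded_bilinear_scaleC [bounded_bilinear]: "bounded_bilinear (scaleC :: complex \<Rightarrow> 'a::chilbert_space \<Rightarrow> 'a)"
proof
  show "scaleC (r *\<^sub>R a) b = r *\<^sub>R scaleC a b" for r a and b :: 'a
    by (simp flip: scaleC_of_real add: scaleR_conv_of_real)
  show "scaleC a (r *\<^sub>R b) = r *\<^sub>R scaleC a b" for r a and b :: 'a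
    by (simp flip: scaleC_of_real add: mult.commute)
  show "\<exists>K. \<forall>a (b::'a). norm (scaleC a b) \<le> norm a * norm b * K"
    by (intro exI[of _ 1]) simp
qed (simp_all add: scaleC_add_left scaleC_add_right)

lemmas bounded_linear_cinner_right = bounded_bilinear.bounded_linear_right[OF bounded_bilinear_cinner]
lemmas bounded_linear_cinner_left = bounded_bilinear.bounded_linear_left[OF bounded_bilinear_cinner]
lemmas bounded_linear_scaleC_right = bounded_bilinear.bounded_linear_right[OF bounded_bilinear_scaleC]

text \<open>For small t of sign opposite to d the linear term wins. The witness -d / (c + 1) is
  close to the minimizer -d / c but also makes sense for c = 0.\<close>

lemma quadratic_nonneg_imp_zero:
  fixes c d :: real
  assumes "c \<ge> 0" "\<And>t. 2 * t * d + t\<^sup>2 * c \<ge> 0"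
  shows "d = 0"
proof (rule ccontr)
  assume "d \<noteq> 0"
  have "2 * (- d / (c + 1)) * d + (- d / (c + 1))\<^sup>2 * c = - (d\<^sup>2 * (c + 2)) / (c + 1)\<^sup>2"
  proof -
    have "c + 1 \<noteq> 0" using assms(1) by simp
    then show ?thesis by (simp add: divide_simps power2_eq_square) algebra
  qed
  also have "\<dots> < 0"
    using assms(1) \<open>d \<noteq> 0\<close> by (intro divide_neg_pos) auto
  finally show False using assms(2)[of "- d / (c + 1)"] by simp
qed

text \<open>
  The representing vector is the limit of a minimizing sequence of \<open>\<parallel>L x\<parallel>\<^sup>2 - 2 \<phi> x\<close>. With \<open>L\<close> the
  identity this gives orthogonal projections and the Riesz theorem; with \<open>L = |A|\<close> and
  \<open>\<phi> x = \<langle>v, A x\<rangle>\<close> it gives the polar decomposition.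
\<close>

lemma riesz_range:
  fixes L :: "'c::real_vector \<Rightarrow> 'a::{real_inner,complete_space}" and \<phi> :: "'c \<Rightarrow> real"
  assumes M: "subspace M" and L: "linear L" and \<phi>: "linear \<phi>"
    and bd: "\<And>x. x \<in> M \<Longrightarrow> \<bar>\<phi> x\<bar> \<le> K * norm (L x)"
  obtains w where "w \<in> closure (L ` M)" "\<And>x. x \<in> M \<Longrightarrow> inner w (L x) = \<phi> x"
proof -
  define J where "J x = (norm (L x))\<^sup>2 - 2 * \<phi> x" for x
  have J_lower: "J x \<ge> - K\<^sup>2" if "x \<in> M" for x
  proof -
    have "0 \<le> (norm (L x) - K)\<^sup>2" by simp
    then have "- K\<^sup>2 \<le> (norm (L x))\<^sup>2 - 2 * (K * norm (L x))"
      by (simp add: power2_diff algebra_simps)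
    then show ?thesis using bd[OF that] unfolding J_def by linarith
  qed
  define I where "I = Inf (J ` M)"
  have bdd: "bdd_below (J ` M)" using J_lower by (intro bdd_belowI[of _ "- K\<^sup>2"]) auto
  have "0 \<in> M" using M by (simp add: subspace_0)
  have I_le: "I \<le> J x" if "x \<in> M" for x
    unfolding I_def using bdd that by (intro cInf_lower) auto
  have "\<exists>x\<in>M. J x < I + 1 / real (Suc n)" for n
  proof -
    have "Inf (J ` M) < I + 1 / real (Suc n)" by (simp add: I_def)
    then show ?thesis
      using cInf_lessD[of "J ` M"] \<open>0 \<in> M\<close> by auto
  qed
  then obtain X where X: "\<And>n. X n \<in> M" "\<And>n. J (X n) < I + 1 / real (Suc n)" by metis
  have dist_le: "(norm (L (X m) - L (X n)))\<^sup>2 \<le> 2 / real (Suc m) + 2 / real (Suc n)" for m n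
  proof -
    let ?z = "(1/2) *\<^sub>R (X m + X n)"
    have "?z \<in> M" using M X by (intro subspace_scale subspace_add)
    then have "I \<le> J ?z" by (rule I_le)
    \<comment> \<open>Parallelogram law: the linear part of \<open>J\<close> cancels against the
      midpoint, and \<open>J\<close> is at least \<open>I\<close> there, so near-minimizers have
      nearby images.\<close>
    moreover have "(norm (L (X m) - L (X n)))\<^sup>2 = 2 * J (X m) + 2 * J (X n) - 4 * J ?z"
    proof -
      have Lz: "L ?z = (1/2) *\<^sub>R (L (X m) + L (X n))"
        and pz: "\<phi> ?z = (1/2) * (\<phi> (X m) + \<phi> (X n))"
        using L \<phi> by (simp_all add: linear_cmul linear_add)
      show ?thesis
        unfolding J_def Lz pz power2_norm_eq_inner
        by (simp add: inner_diff_left inner_diff_right inner_add_left inner_add_right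
            inner_commute[of "L (X n)" "L (X m)"] field_simps)
    qed
    ultimately show ?thesis using X(2)[of m] X(2)[of n] by simp
  qed
  have "Cauchy (\<lambda>n. L (X n))"
  proof (rule metric_CauchyI)
    fix e :: real assume "e > 0"
    then obtain N where N: "4 / e\<^sup>2 < real N" using reals_Archimedean2 by blast
    show "\<exists>M. \<forall>m\<ge>M. \<forall>n\<ge>M. dist (L (X m)) (L (X n)) < e"
    proof (intro exI allI impI)
      fix m n assume mn: "m \<ge> N" "n \<ge> N"
      have "2 / real (Suc m) \<le> 2 / real (Suc N)" "2 / real (Suc n) \<le> 2 / real (Suc N)"
        using mn by (auto intro!: divide_left_mono)
      then have "(norm (L (X m) - L (X n)))\<^sup>2 \<le> 4 / real (Suc N)"
        using dist_le[of m n] by simp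
      also have "4 / real (Suc N) < e\<^sup>2"
        using N \<open>e > 0\<close> by (simp add: field_simps)
           (smt (verit) mult_less_cancel_right_pos zero_less_power mult_nonneg_nonneg)
      finally show "dist (L (X m)) (L (X n)) < e"
        using \<open>e > 0\<close> by (simp add: dist_norm power_less_imp_less_base)
    qed
  qed
  then obtain w where w: "(\<lambda>n. L (X n)) \<longlonglongrightarrow> w"
    using Cauchy_convergent_iff convergent_def by blast
  have "w \<in> closure (L ` M)"
    unfolding closure_sequential using w X(1) by (intro exI[of _ "\<lambda>n. L (X n)"]) auto
  moreover have "inner w (L x) = \<phi> x" if x: "x \<in> M" for x
  proof -
    \<comment> \<open>First variation. The limit \<open>w\<close> need not be of the form L y, so
      the variation is taken at \<open>X n\<close>, up to 1 / (n + 1), and the limit is formed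
      afterwards.\<close>
    have "2 * t * (inner w (L x) - \<phi> x) + t\<^sup>2 * (norm (L x))\<^sup>2 \<ge> 0" for t
    proof -
      have "- (1 / real (Suc n)) \<le> 2 * t * (inner (L (X n)) (L x) - \<phi> x) + t\<^sup>2 * (norm (L x))\<^sup>2" for n
      proof -
        have "X n + t *\<^sub>R x \<in> M" using M X x by (intro subspace_scale subspace_add)
        then have "I \<le> J (X n + t *\<^sub>R x)" by (rule I_le)
        also have "\<dots> = J (X n) + 2 * t * (inner (L (X n)) (L x) - \<phi> x) + t\<^sup>2 * (norm (L x))\<^sup>2"
          using L \<phi> unfolding J_def power2_norm_eq_inner
          by (simp add: linear_cmul linear_add inner_add_left inner_add_right
            inner_commute[of "L x" "L (X n)"] algebra_simps power2_eq_square)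
        finally show ?thesis using X(2)[of n] by linarith
      qed
      moreover have "(\<lambda>n. 2 * t * (inner (L (X n)) (L x) - \<phi> x) + t\<^sup>2 * (norm (L x))\<^sup>2)
          \<longlonglongrightarrow> 2 * t * (inner w (L x) - \<phi> x) + t\<^sup>2 * (norm (L x))\<^sup>2"
        by (intro tendsto_intros w)
      moreover have "(\<lambda>n. - (1 / real (Suc n))) \<longlonglongrightarrow> - 0"
        using LIMSEQ_inverse_real_of_nat by (intro tendsto_minus) (simp add: inverse_eq_divide)
      ultimately show ?thesis
        by (intro tendsto_le[OF trivial_limit_sequentially, of _ _ "\<lambda>n. - (1 / real (Suc n))" 0]) auto
    qed
    then have "inner w (L x) - \<phi> x = 0"
      by (rule quadratic_nonneg_imp_zero[rotated]) simp
    then show ?thesis by simp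
  qed
  ultimately show thesis by (rule that)
qed

section \<open>Bounded operators and adjoints\<close>

text \<open>Im <w, x> is the real inner product of i w with x. This carries the real Riesz argument
  over to complex inner products.\<close>

lemma cinner_eqI_inner:
  assumes "inner w x = inner y z" "inner (scaleC \<i> w) x = inner (scaleC \<i> y) z"
  shows "cinner w x = cinner y z"
  using assms by (simp add: complex_eq_iff Im_cinner flip: inner_eq_Re_cinner)

lemma bounded_clinearI:
  assumes "\<And>x y. A (x + y) = A x + A y" "\<And>c x. A (scaleC c x) = scaleC c (A x)"
    "\<And>x. norm (A x) \<le> K * norm x"
  shows "bounded_clinear A"
  unfolding bounded_clinear_def
proof (intro conjI allI assms(2) bounded_linear_intro[where K = K])
  show "A (r *\<^sub>R x) = r *\<^sub>R A x" for r x by (metis assms(2) scaleC_of_real)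
qed (use assms in \<open>auto simp: mult.commute\<close>)

lemma bounded_clinear_bounded_linear: "bounded_clinear A \<Longrightarrow> bounded_linear A"
  and bounded_clinear_scaleC: "bounded_clinear A \<Longrightarrow> A (scaleC c x) = scaleC c (A x)"
  by (auto simp: bounded_clinear_def)

lemma bounded_clinear_linear: "bounded_clinear A \<Longrightarrow> linear A"
  by (simp add: bounded_clinear_bounded_linear bounded_linear.linear)

lemma bounded_clinear_bound:
  assumes "bounded_clinear A"
  obtains K where "K > 0" "\<And>x. norm (A x) \<le> K * norm x"
  using bounded_linear.pos_bounded[OF bounded_clinear_bounded_linear[OF assms]]
  by (metis mult.commute)

lemma bounded_clinear_compose:
  "bounded_clinear A \<Longrightarrow> bounded_clinear B \<Longrightarrow> bounded_clinear (\<lambda>x. A (B x))"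
  by (simp add: bounded_clinear_def bounded_linear_compose)

lemma bounded_clinear_add:
  "bounded_clinear A \<Longrightarrow> bounded_clinear B \<Longrightarrow> bounded_clinear (\<lambda>x. A x + B x)"
  by (simp add: bounded_clinear_def bounded_linear_add scaleC_add_right)

lemma bounded_clinear_sub:
  "bounded_clinear A \<Longrightarrow> bounded_clinear B \<Longrightarrow> bounded_clinear (\<lambda>x. A x - B x)"
  by (simp add: bounded_clinear_def bounded_linear_sub complex_vector.scale_right_diff_distrib)

lemma bounded_clinear_zero: "bounded_clinear (\<lambda>x. 0)"
  by (simp add: bounded_clinear_def bounded_linear_zero)

lemma bounded_clinear_scale: "bounded_clinear A \<Longrightarrow> bounded_clinear (\<lambda>x. scaleC c (A x))"
  by (simp add: bounded_clinear_def bounded_linear_compose[OF bounded_linear_scaleC_right] mult.commute)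

lemma bounded_clinear_sum:
  "(\<And>i. i \<in> I \<Longrightarrow> bounded_clinear (A i)) \<Longrightarrow> bounded_clinear (\<lambda>x. \<Sum>i\<in>I. A i x)"
  by (induction I rule: infinite_finite_induct) (auto intro: bounded_clinear_zero bounded_clinear_add)

lemma cadjoint_eqI:
  assumes "\<And>x y. cinner (B y) x = cinner y (A x)"
  shows "cadjoint A = B"
  unfolding cadjoint_def
proof (rule the_equality)
  show "C = B" if "\<forall>x y. cinner (C y) x = cinner y (A x)" for C
  proof
    fix y
    show "C y = B y"
      using that assms by (intro cinner_extI) (metis cinner_commute)
  qed
qed (use assms in auto)

text \<open>\<open>riesz_range\<close> with L the identity represents x -> <y, A x>. The constant
  \<open>K\<close> is carried along so that adjoints of contractions are seen to be
  contractions.\<close>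

lemma adjoint_exists:
  assumes A: "bounded_clinear A" and K: "\<And>x. norm (A x) \<le> K * norm x" and "K \<ge> 0"
  obtains B where "bounded_clinear B" "\<And>x y. cinner (B y) x = cinner y (A x)"
    "\<And>y. norm (B y) \<le> K * norm y"
proof -
  have "\<exists>w. \<forall>x. inner w x = inner y (A x)" for y
  proof -
    have "linear (\<lambda>x. inner y (A x))"
      using bounded_clinear_linear[OF A]
      by (intro linearI) (simp_all add: linear_add linear_cmul inner_add_right)
    moreover have "\<bar>inner y (A x)\<bar> \<le> norm y * K * norm (id x)" for x
      using order_trans[OF Cauchy_Schwarz_ineq2 mult_left_mono[OF K]] by (simp add: mult.assoc)
    ultimately show ?thesis
      using riesz_range[of UNIV id "\<lambda>x. inner y (A x)" "norm y * K"] by (metis UNIV_I id_apply linear_id subspace_UNIV)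
  qed
  then obtain B where B: "\<And>x y. inner (B y) x = inner y (A x)" by metis
  have Bc: "cinner (B y) x = cinner y (A x)" for x y
  proof -
    have "inner (scaleC \<i> (B y)) x = inner (B y) (scaleC (-\<i>) x)"
      by (simp only: inner_eq_Re_cinner cinner_scaleC_left cinner_scaleC_right) simp
    also have "\<dots> = inner y (scaleC (-\<i>) (A x))" by (simp only: B bounded_clinear_scaleC[OF A])
    also have "\<dots> = inner (scaleC \<i> y) (A x)"
      by (simp only: inner_eq_Re_cinner cinner_scaleC_left cinner_scaleC_right) simp
    finally show ?thesis by (intro cinner_eqI_inner B)
  qed
  have nB: "norm (B y) \<le> K * norm y" for y
  proof (cases "B y = 0")
    case True
    then show ?thesis using \<open>K \<ge> 0\<close> by simp
  next
    case False
    have "norm (B y) * norm (B y) = inner y (A (B y))"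
      using B[of y "B y"] by (simp add: power2_norm_eq_inner[symmetric] power2_eq_square)
    also have "\<dots> \<le> norm y * (K * norm (B y))"
      by (rule order_trans[OF norm_cauchy_schwarz mult_left_mono[OF K]]) simp
    also have "\<dots> = (K * norm y) * norm (B y)" by simp
    finally show ?thesis using False by (simp only: mult_le_cancel_right) simp
  qed
  have "bounded_clinear B"
  proof (rule bounded_clinearI[OF _ _ nB])
    show "B (x + y) = B x + B y" for x y
      by (rule cinner_extI) (metis Bc cinner_add_left cinner_commute)
    show "B (scaleC c x) = scaleC c (B x)" for c x
    proof (rule cinner_extI)
      fix z
      have "cinner (B (scaleC c x)) z = cinner (scaleC c (B x)) z" by (simp add: Bc cinner_scaleC_left)
      then show "cinner z (B (scaleC c x)) = cinner z (scaleC c (B x))" by (metis cinner_commute)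
    qed
  qed
  then show thesis using Bc nB by (rule that)
qed

lemma
  assumes "bounded_clinear A"
  shows bounded_clinear_cadjoint: "bounded_clinear (cadjoint A)"
    and cinner_cadjoint_left: "cinner (cadjoint A y) x = cinner y (A x)"
    and cinner_cadjoint_right: "cinner x (cadjoint A y) = cinner (A x) y"
proof -
  obtain K where K: "K > 0" "\<And>x. norm (A x) \<le> K * norm x" using bounded_clinear_bound[OF assms] by metis
  obtain B where B: "bounded_clinear B" "\<And>x y. cinner (B y) x = cinner y (A x)"
    using adjoint_exists[OF assms K(2)] less_imp_le[OF K(1)] by metis
  then have "cadjoint A = B" by (intro cadjoint_eqI)
  with B show "bounded_clinear (cadjoint A)" "cinner (cadjoint A y) x = cinner y (A x)"
    "cinner x (cadjoint A y) = cinner (A x) y"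
    by (auto, metis cinner_commute)
qed

lemma norm_cadjoint_le:
  assumes A: "bounded_clinear A" and K: "\<And>x. norm (A x) \<le> K * norm x" and "K \<ge> 0"
  shows "norm (cadjoint A y) \<le> K * norm y"
  using adjoint_exists[OF assms] cadjoint_eqI by metis

section \<open>Square roots and absolute values\<close>

text \<open>Square roots are built over the real inner product, where the Banach space of
  \<open>blinfun\<close>s hosts the iteration. Complex linearity of the root is recovered from its
  commuting with all scalars.\<close>

definition pos_symmetric :: "('a::real_inner \<Rightarrow> 'a) \<Rightarrow> bool" where
  "pos_symmetric A \<longleftrightarrow> bounded_linear A \<and> (\<forall>x y. inner (A x) y = inner x (A y)) \<and> (\<forall>x. inner x (A x) \<ge> 0)"

lemma pos_symmetric_contraction:
  assumes X: "pos_symmetric X" and le: "\<And>x. inner x (X x) \<le> (norm x)\<^sup>2"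
  shows "norm (X x) \<le> norm x"
proof -
  have lin: "X (a - b) = X a - X b" for a b
    using X by (auto simp: pos_symmetric_def bounded_linear.linear linear_diff)
  have sym: "inner (X a) b = inner a (X b)" for a b using X by (auto simp: pos_symmetric_def)
  \<comment> \<open>\<open>X - X\<^sup>2 = X (1 - X) X + (1 - X) X (1 - X)\<close>\<close>
  have "inner (x - X x) (X (x - X x)) \<ge> 0" using X by (auto simp: pos_symmetric_def)
  moreover have "inner (X x) (X (X x)) \<le> inner (X x) (X x)"
    using le[of "X x"] by (simp add: power2_norm_eq_inner)
  ultimately have "inner (X x) (X x) \<le> inner x (X x)"
    by (simp add: lin inner_diff_left inner_diff_right sym)
  also have "\<dots> \<le> (norm x)\<^sup>2" by (rule le)
  finally show ?thesis by (simp add: power2_norm_eq_inner[symmetric])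
qed

text \<open>
  For \<open>0 \<le> B \<le> 1\<close> the iteration \<open>Y \<mapsto> (1 - B + Y\<^sup>2) / 2\<close> converges in norm to \<open>1 - \<surd>B\<close>: the increments
  of the operator iteration are dominated by those of the scalar iteration \<open>y \<mapsto> (1 + y\<^sup>2) / 2\<close>.
\<close>

lemma pos_symmetric_sqrt:
  fixes B :: "'a::{real_inner,banach} \<Rightarrow> 'a"
  assumes B: "pos_symmetric B"
  obtains R where "pos_symmetric R" "\<And>x. R (R x) = B x"
    "\<And>C x. bounded_linear C \<Longrightarrow> (\<And>x. C (B x) = B (C x)) \<Longrightarrow> C (R x) = R (C x)"
proof -
  have blB: "bounded_linear B" and symB: "\<And>x y. inner (B x) y = inner x (B y)"
    and posB: "\<And>x. inner x (B x) \<ge> 0"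
    using B by (auto simp: pos_symmetric_def)
  obtain M where M: "M > 0" "\<And>x. norm (B x) \<le> norm x * M"
    using bounded_linear.pos_bounded[OF blB] by blast
  \<comment> \<open>Dividing by \<open>M\<close> brings B below 1, so that X is a positive
    contraction; the factor returns as \<open>sqrt M\<close> in \<open>R\<close>.\<close>
  define X where "X = id_blinfun - (1 / M) *\<^sub>R Blinfun B"
  have X: "blinfun_apply X x = x - (1 / M) *\<^sub>R B x" for x
    by (simp add: X_def minus_blinfun.rep_eq scaleR_blinfun.rep_eq bounded_linear_Blinfun_apply blB)
  have "norm (blinfun_apply X x) \<le> norm x" for x
  proof (rule pos_symmetric_contraction)
    have "inner x (blinfun_apply X x) \<ge> 0" for x
    proof -
      have "inner x (B x) \<le> norm x * (norm x * M)"
        by (rule order_trans[OF norm_cauchy_schwarz mult_left_mono[OF M(2)]]) simp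
      then show ?thesis using M(1) by (simp add: X inner_diff_right field_simps dot_square_norm power2_eq_square)
    qed
    then show "pos_symmetric (blinfun_apply X)"
      by (auto simp: pos_symmetric_def X inner_diff_right inner_diff_left symB bounded_linear_blinfun_apply)
    show "inner x (blinfun_apply X x) \<le> (norm x)\<^sup>2" for x
      using posB M by (simp add: X inner_diff_right dot_square_norm)
  qed
  then have nX: "norm X \<le> 1" by (intro norm_blinfun_bound) auto
  define Y where "Y = rec_nat 0 (\<lambda>_ Y. (1 / 2) *\<^sub>R (X + (Y o\<^sub>L Y)))"
  define y :: "nat \<Rightarrow> real" where "y = rec_nat 0 (\<lambda>_ y. (1 + y\<^sup>2) / 2)"
  have Y0: "Y 0 = 0" and YS: "Y (Suc n) = (1 / 2) *\<^sub>R (X + (Y n o\<^sub>L Y n))" for n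
    by (simp_all add: Y_def)
  have y0: "y 0 = 0" and yS: "y (Suc n) = (1 + (y n)\<^sup>2) / 2" for n
    by (simp_all add: y_def)
  have y01: "0 \<le> y n \<and> y n \<le> 1" for n
  proof (induction n)
    case (Suc n)
    then have "(y n)\<^sup>2 \<le> 1" by (simp add: power_le_one)
    then show ?case by (simp add: yS)
  qed (simp add: y0)
  have yinc: "y n \<le> y (Suc n)" for n
    using zero_le_power2[of "1 - y n"] by (simp add: yS power2_diff)
  have Yy: "norm (Y n) \<le> y n \<and> norm (Y (Suc n) - Y n) \<le> y (Suc n) - y n" for n
  proof (induction n)
    case 0
    then show ?case using nX by (simp add: Y0 y0 YS yS)
  next
    case (Suc n)
    have 1: "norm (Y (Suc n)) \<le> y (Suc n)"
      using Suc norm_triangle_ineq[of "Y (Suc n) - Y n" "Y n"] by auto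
    \<comment> \<open>The splitting S S - Q Q = S (S - Q) + (S - Q) Q needs no commutation, and each
      factor is already dominated by its scalar counterpart.\<close>
    have "Y (Suc (Suc n)) - Y (Suc n) = (1 / 2) *\<^sub>R ((Y (Suc n) o\<^sub>L (Y (Suc n) - Y n)) + ((Y (Suc n) - Y n) o\<^sub>L Y n))"
    proof -
      have "Y (Suc (Suc n)) - Y (Suc n) = (1 / 2) *\<^sub>R ((Y (Suc n) o\<^sub>L Y (Suc n)) - (Y n o\<^sub>L Y n))"
      proof -
        have "Y (Suc (Suc n)) - Y (Suc n)
            = (1 / 2) *\<^sub>R (X + (Y (Suc n) o\<^sub>L Y (Suc n))) - (1 / 2) *\<^sub>R (X + (Y n o\<^sub>L Y n))"
          by (simp only: YS[of "Suc n"] YS[of n])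
        then show ?thesis by (simp only: scaleR_diff_right[symmetric] add_diff_cancel_left)
      qed
      then show ?thesis
        by (simp add: bounded_bilinear.diff_left[OF bounded_bilinear_blinfun_compose]
            bounded_bilinear.diff_right[OF bounded_bilinear_blinfun_compose])
    qed
    then have "norm (Y (Suc (Suc n)) - Y (Suc n))
      \<le> (1 / 2) * (norm (Y (Suc n) o\<^sub>L (Y (Suc n) - Y n)) + norm ((Y (Suc n) - Y n) o\<^sub>L Y n))"
      using norm_triangle_ineq by (simp add: divide_right_mono)
    also have "\<dots> \<le> (1 / 2) * (y (Suc n) * (y (Suc n) - y n) + (y (Suc n) - y n) * y n)"
    proof -
      have "norm (Y (Suc n) o\<^sub>L (Y (Suc n) - Y n)) \<le> y (Suc n) * (y (Suc n) - y n)"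
        using 1 Suc y01 by (intro order_trans[OF norm_blinfun_compose mult_mono]) auto
      moreover have "norm ((Y (Suc n) - Y n) o\<^sub>L Y n) \<le> (y (Suc n) - y n) * y n"
        using 1 Suc y01 yinc by (intro order_trans[OF norm_blinfun_compose mult_mono]) auto
      ultimately show ?thesis by simp
    qed
    also have "\<dots> = y (Suc (Suc n)) - y (Suc n)"
      unfolding yS[of "Suc n"] using yS[of n] by (simp add: field_simps power2_eq_square)
    finally show ?case using 1 by simp
  qed
  have Ydist: "norm (Y (m + k) - Y m) \<le> y (m + k) - y m" for m k
  proof (induction k)
    case (Suc k)
    have "norm (Y (m + Suc k) - Y m) \<le> norm (Y (Suc (m + k)) - Y (m + k)) + norm (Y (m + k) - Y m)"
      using norm_triangle_ineq[of "Y (Suc (m + k)) - Y (m + k)" "Y (m + k) - Y m"] by simp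
    then show ?case using Suc Yy[of "m + k"] by simp
  qed auto
  have "incseq y" using yinc by (rule incseq_SucI)
  then have "convergent y"
    using y01 by (intro Bseq_monoseq_convergent BseqI'[of _ 1]) (auto simp: monoseq_iff)
  then have "Cauchy y" by (rule convergent_Cauchy)
  have "Cauchy Y"
  proof (rule CauchyI)
    fix e :: real assume "e > 0"
    then obtain N where N: "\<And>m n. m \<ge> N \<Longrightarrow> n \<ge> N \<Longrightarrow> norm (y m - y n) < e"
      using CauchyD[OF \<open>Cauchy y\<close>] by blast
    have "norm (Y m - Y n) < e" if "N \<le> m" "N \<le> n" for m n
    proof (cases "m \<le> n")
      case True
      then show ?thesis
        using Ydist[of m "n - m"] N[of n m] that by (simp add: norm_minus_commute)
    next
      case False
      then show ?thesis using Ydist[of n "m - n"] N[of m n] that by simp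
    qed
    then show "\<exists>M. \<forall>m\<ge>M. \<forall>n\<ge>M. norm (Y m - Y n) < e" by blast
  qed
  then obtain Z where Z: "Y \<longlonglongrightarrow> Z" by (auto simp: Cauchy_convergent_iff convergent_def)
  have "(\<lambda>n. Y (Suc n)) \<longlonglongrightarrow> (1 / 2) *\<^sub>R (X + (Z o\<^sub>L Z))"
    unfolding YS by (intro tendsto_intros Z)
  then have "Z = (1 / 2) *\<^sub>R (X + (Z o\<^sub>L Z))" using Z LIMSEQ_Suc LIMSEQ_unique by blast
  then have Zfix: "2 *\<^sub>R blinfun_apply Z x = blinfun_apply X x + blinfun_apply Z (blinfun_apply Z x)" for x
    by (metis (no_types, lifting) blinfun.add_left blinfun.scaleR_left blinfun_apply_blinfun_compose
        scaleR_scaleR divide_self mult.commute times_divide_eq_left mult_1 scaleR_one zero_neq_numeral)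
  have Zapp: "(\<lambda>n. blinfun_apply (Y n) x) \<longlonglongrightarrow> blinfun_apply Z x" for x
    by (intro tendsto_intros Z)
  have nZ: "norm Z \<le> 1"
    using Yy y01 by (intro LIMSEQ_le_const2[OF tendsto_norm[OF Z]]) (meson order_trans)
  have symY: "inner (blinfun_apply (Y n) x) z = inner x (blinfun_apply (Y n) z)" for n x z
    by (induction n arbitrary: x z)
       (auto simp: Y0 YS blinfun.add_left blinfun.scaleR_left X inner_diff_left inner_diff_right
         inner_add_left inner_add_right symB)
  have symZ: "inner (blinfun_apply Z x) z = inner x (blinfun_apply Z z)" for x z
  proof (rule LIMSEQ_unique)
    show "(\<lambda>n. inner (blinfun_apply (Y n) x) z) \<longlonglongrightarrow> inner (blinfun_apply Z x) z"
      by (intro tendsto_intros Zapp)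
    show "(\<lambda>n. inner (blinfun_apply (Y n) x) z) \<longlonglongrightarrow> inner x (blinfun_apply Z z)"
      unfolding symY by (intro tendsto_intros Zapp)
  qed
  \<comment> \<open>The fixed point equation 2 Z = X + Z Z gives M (1 - Z)^2 = M (1 - X) = B, and
    norm Z \<le> 1 makes 1 - Z positive.\<close>
  define R where "R x = sqrt M *\<^sub>R (x - blinfun_apply Z x)" for x
  have "pos_symmetric R"
    unfolding pos_symmetric_def
  proof (intro conjI allI)
    show "bounded_linear R"
      unfolding R_def by (intro bounded_linear_intros)
    show "inner (R x) z = inner x (R z)" for x z
      by (simp add: R_def inner_diff_left inner_diff_right symZ)
    show "0 \<le> inner x (R x)" for x
    proof -
      have "norm (blinfun_apply Z x) \<le> 1 * norm x"
        by (rule order_trans[OF norm_blinfun mult_right_mono[OF nZ]]) simp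
      then have "inner x (blinfun_apply Z x) \<le> norm x * (1 * norm x)"
        by (rule order_trans[OF norm_cauchy_schwarz mult_left_mono]) simp
      then show ?thesis using M(1) by (simp add: R_def inner_diff_right dot_square_norm power2_eq_square)
    qed
  qed
  moreover have "R (R x) = B x" for x
  proof -
    have "R (R x) = M *\<^sub>R (x - 2 *\<^sub>R blinfun_apply Z x + blinfun_apply Z (blinfun_apply Z x))"
      using M(1) by (simp add: R_def blinfun.scaleR_right blinfun.diff_right scaleR_2 algebra_simps
          flip: scaleR_diff_right)
    then show ?thesis using M(1) by (simp add: Zfix X)
  qed
  \<comment> \<open>Each iterate is a polynomial in B, so whatever commutes with B commutes with the
    limit. This clause later yields both complex linearity and uniqueness of the root.\<close>
  moreover have "C (R x) = R (C x)" if C: "bounded_linear C" "\<And>x. C (B x) = B (C x)" for C x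
  proof -
    interpret C: bounded_linear C by fact
    have CY: "C (blinfun_apply (Y n) x) = blinfun_apply (Y n) (C x)" for n x
      by (induction n arbitrary: x)
         (auto simp: Y0 YS blinfun.add_left blinfun.scaleR_left X C.add C.diff C.scaleR C(2) C.zero)
    have "C (blinfun_apply Z x) = blinfun_apply Z (C x)"
    proof (rule LIMSEQ_unique)
      show "(\<lambda>n. C (blinfun_apply (Y n) x)) \<longlonglongrightarrow> C (blinfun_apply Z x)"
        by (intro C.tendsto Zapp)
      show "(\<lambda>n. C (blinfun_apply (Y n) x)) \<longlonglongrightarrow> blinfun_apply Z (C x)"
        unfolding CY by (rule Zapp)
    qed
    then show ?thesis by (simp add: R_def C.diff C.scaleR)
  qed
  ultimately show thesis by (rule that)
qed

text \<open>Writing S as R R turns <x, S x> into the square of norm (R x).\<close>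

lemma pos_symmetric_null:
  fixes S :: "'a::{real_inner,banach} \<Rightarrow> 'a"
  assumes "pos_symmetric S" "inner x (S x) = 0"
  shows "S x = 0"
proof -
  obtain R where R: "pos_symmetric R" "\<And>x. R (R x) = S x"
    using pos_symmetric_sqrt[OF assms(1)] by metis
  then have "inner (R x) (R x) = 0" using assms(2) by (simp add: pos_symmetric_def)
  then have "R x = 0" by simp
  then have "R (R x) = 0" using R(1) by (simp add: pos_symmetric_def bounded_linear.linear linear_0)
  then show ?thesis using R(2) by simp
qed

text \<open>Every positive root T of P P commutes with P P = T T, hence with the constructed root S.
  For y = (S - T) x this gives (S + T) y = 0; both <y, S y> and <y, T y> are nonnegative, so S y = T
  y = 0, and <y, y> = <x, (S - T) y> vanishes.\<close>

lemma pos_symmetric_sqrt_unique: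
  fixes P Q :: "'a::{real_inner,banach} \<Rightarrow> 'a"
  assumes P: "pos_symmetric P" and Q: "pos_symmetric Q"
    and eq: "\<And>x. P (P x) = Q (Q x)"
  shows "P = Q"
proof -
  have blP: "bounded_linear P" and symP: "\<And>x y. inner (P x) y = inner x (P y)"
    using P by (auto simp: pos_symmetric_def)
  have "pos_symmetric (\<lambda>x. P (P x))"
    unfolding pos_symmetric_def
  proof (intro conjI allI bounded_linear_compose[OF blP blP])
    show "inner (P (P x)) y = inner x (P (P y))" for x y by (simp only: symP)
    show "0 \<le> inner x (P (P x))" for x by (metis symP inner_ge_zero)
  qed
  then obtain S where S: "pos_symmetric S" "\<And>x. S (S x) = P (P x)"
    and comm: "\<And>C x. bounded_linear C \<Longrightarrow> (\<And>x. C (P (P x)) = P (P (C x))) \<Longrightarrow> C (S x) = S (C x)"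
    using pos_symmetric_sqrt[of "\<lambda>x. P (P x)"] by blast
  have "T = S" if T: "pos_symmetric T" "\<And>x. T (T x) = P (P x)" for T
  proof
    fix x
    define y where "y = S x - T x"
    interpret S: bounded_linear S using S(1) by (simp add: pos_symmetric_def)
    interpret T: bounded_linear T using T(1) by (simp add: pos_symmetric_def)
    have TS: "T (S x) = S (T x)" for x
      by (rule comm[OF T.bounded_linear_axioms]) (metis T(2))
    have "S y + T y = 0"
      by (simp add: y_def S.diff T.diff S(2) T(2) TS)
    then have "inner y (S y) + inner y (T y) = 0" by (metis inner_add_right inner_zero_right)
    moreover have "inner y (S y) \<ge> 0" "inner y (T y) \<ge> 0"
      using S(1) T(1) by (auto simp: pos_symmetric_def)
    ultimately have "S y = 0" "T y = 0"
      using pos_symmetric_null S(1) T(1) by (metis add_nonneg_eq_0_iff)+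
    then have "inner y y = 0"
      using S(1) T(1) by (simp add: y_def inner_diff_left pos_symmetric_def)
    then show "T x = S x" by (simp add: y_def)
  qed
  from this[OF P] this[OF Q] eq show ?thesis by simp
qed

section \<open>Complex positive operators and the absolute value\<close>

lemma positive_op_pos_symmetric:
  assumes "positive_op A"
  shows "pos_symmetric A"
proof -
  have A: "bounded_clinear A" and pos: "\<And>x. cinner x (A x) \<in> \<real>\<^sub>\<ge>\<^sub>0"
    using assms by (auto simp: positive_op_def)
  have re: "Im (cinner x (A x)) = 0" "Re (cinner x (A x)) \<ge> 0" for x
    using pos[of x] by (auto simp: complex_nonneg_Reals_iff)
  have "inner (A x) y = inner x (A y)" for x y
  proof -
    \<comment> \<open>Over the complex numbers positivity forces symmetry: the mixed terms in <x + i
      y, A (x + i y)> have imaginary part Re <x, A y> - Re <y, A x>.\<close>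
    have "Im (cinner (x + scaleC \<i> y) (A (x + scaleC \<i> y))) = 0" by (rule re)
    then show ?thesis
      using re[of x] re[of y] A
      by (simp add: linear_add[OF bounded_clinear_linear] bounded_clinear_scaleC cinner_add_left
          cinner_add_right cinner_scaleC_left cinner_scaleC_right flip: inner_eq_Re_cinner)
         (simp add: inner_commute)
  qed
  then show ?thesis
    using bounded_clinear_bounded_linear[OF A] re(2)
    by (auto simp: pos_symmetric_def inner_eq_Re_cinner)
qed

lemma positive_op_symmetric:
  assumes "positive_op A"
  shows "cinner (A x) y = cinner x (A y)"
proof -
  have "inner (A x) y = inner x (A y)" for x y
    using positive_op_pos_symmetric[OF assms] by (simp add: pos_symmetric_def)
  from this[of x] this[of "scaleC \<i> x"] show ?thesis
    using assms by (intro cinner_eqI_inner) (simp_all add: positive_op_def bounded_clinear_scaleC)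
qed

lemma pos_symmetric_positive_op:
  assumes B: "pos_symmetric B" and c: "\<And>c x. B (scaleC c x) = scaleC c (B x)"
  shows "positive_op B"
  unfolding positive_op_def
proof (intro conjI allI)
  show "bounded_clinear B" using assms by (simp add: bounded_clinear_def pos_symmetric_def)
  fix x
  have "Im (cinner x (B x)) = inner (scaleC \<i> x) (B x)" by (rule Im_cinner)
  also have "\<dots> = inner (scaleC \<i> (B x)) x" using B by (metis c pos_symmetric_def)
  also have "\<dots> = - Im (cinner x (B x))" 
    by (simp add: inner_eq_Re_cinner cinner_scaleC_left) (metis cinner_commute complex_cnj complex.collapse complex.sel(2))
  finally have "Im (cinner x (B x)) = 0" by simp
  moreover have "Re (cinner x (B x)) \<ge> 0"
    using B by (simp add: pos_symmetric_def flip: inner_eq_Re_cinner)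
  ultimately show "cinner x (B x) \<in> \<real>\<^sub>\<ge>\<^sub>0" by (simp add: complex_nonneg_Reals_iff)
qed

lemma positive_op_sqrt:
  assumes "positive_op (A :: 'a::chilbert_space \<Rightarrow> 'a)"
  obtains R where "positive_op R" "\<And>x. R (R x) = A x"
proof -
  obtain R where R: "pos_symmetric R" "\<And>x. R (R x) = A x"
    "\<And>C x. bounded_linear C \<Longrightarrow> (\<And>x. C (A x) = A (C x)) \<Longrightarrow> C (R x) = R (C x)"
    using pos_symmetric_sqrt[OF positive_op_pos_symmetric[OF assms]] by metis
  have "positive_op R"
    using assms R(3)[OF bounded_linear_scaleC_right]
    by (intro pos_symmetric_positive_op R) (simp add: positive_op_def bounded_clinear_scaleC)
  then show thesis using R(2) by (rule that)
qed

lemma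
  assumes A: "bounded_clinear A"
  shows positive_op_abs_op: "positive_op (abs_op A)"
    and cinner_abs_op_abs_op: "cinner (abs_op A x) (abs_op A y) = cinner (A x) (A y)"
proof -
  let ?B = "cadjoint A \<circ> A"
  have "positive_op ?B"
    using bounded_clinear_compose[OF bounded_clinear_cadjoint[OF A] A]
    by (simp add: positive_op_def comp_def cinner_cadjoint_right[OF A] cinner_same)
  then obtain R where R: "positive_op R" "\<And>x. R (R x) = ?B x"
    using positive_op_sqrt[of ?B] by blast
  have "abs_op A = R"
    unfolding abs_op_def
  proof (rule the_equality)
    show "positive_op R \<and> R \<circ> R = ?B" using R by auto
    fix P assume P: "positive_op P \<and> P \<circ> P = ?B"
    then have "P (P x) = R (R x)" for x by (metis R(2) comp_apply)
    then show "P = R"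
      using P R(1) by (intro pos_symmetric_sqrt_unique positive_op_pos_symmetric) auto
  qed
  then show "positive_op (abs_op A)" "cinner (abs_op A x) (abs_op A y) = cinner (A x) (A y)"
    using R(1) by (simp, simp add: positive_op_symmetric[OF R(1)] R(2) cinner_cadjoint_right[OF A])
qed

section \<open>Orthonormal bases\<close>

text \<open>The density principle behind the later extension arguments: a property that cuts out a
  closed subspace need only be checked on generators.\<close>

lemma closed_subspace_eq_UNIV:
  assumes "closure (cspan S) = UNIV" "complex_vector.subspace V" "closed V" "S \<subseteq> V"
  shows "x \<in> V"
  using closure_minimal[OF complex_vector.span_minimal[OF assms(4,2)] assms(3)] assms(1) by auto

lemma bounded_clinear_ext:
  assumes "closure (cspan S) = UNIV" "bounded_clinear A" "bounded_clinear B"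
    and eq: "\<And>x. x \<in> S \<Longrightarrow> A x = B x"
  shows "A = B"
proof
  fix x
  let ?V = "{x. A x = B x}"
  have "complex_vector.subspace ?V"
    using assms(2,3)[THEN bounded_clinear_linear]
    by (intro complex_vector.subspaceI)
       (auto simp: linear_0 linear_add bounded_clinear_scaleC[OF assms(2)] bounded_clinear_scaleC[OF assms(3)])
  moreover have "closed ?V"
    using assms(2,3)[THEN bounded_clinear_bounded_linear]
    by (intro closed_Collect_eq linear_continuous_on)
  ultimately have "x \<in> ?V"
    using eq by (intro closed_subspace_eq_UNIV[OF assms(1)]) auto
  then show "A x = B x" by simp
qed

definition orthonormal_on :: "'j set \<Rightarrow> ('j \<Rightarrow> 'a::chilbert_space) \<Rightarrow> bool" where
  "orthonormal_on J g \<longleftrightarrow> (\<forall>j\<in>J. \<forall>k\<in>J. cinner (g j) (g k) = (if j = k then 1 else 0))"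

lemma orthonormal_basis_orthonormal_on: "orthonormal_basis J g \<Longrightarrow> orthonormal_on J g"
  and orthonormal_basis_dense: "orthonormal_basis J g \<Longrightarrow> closure (cspan (g ` J)) = UNIV"
  by (auto simp: orthonormal_basis_def orthonormal_on_def)

lemma orthonormal_on_subset: "orthonormal_on J g \<Longrightarrow> F \<subseteq> J \<Longrightarrow> orthonormal_on F g"
  unfolding orthonormal_on_def by blast

lemma orthonormal_on_reindex:
  assumes "orthonormal_on F g" "inj_on h I" "h ` I \<subseteq> F"
  shows "orthonormal_on I (\<lambda>i. g (h i))"
  unfolding orthonormal_on_def
proof (intro ballI)
  fix i j assume "i \<in> I" "j \<in> I"
  then show "cinner (g (h i)) (g (h j)) = (if i = j then 1 else 0)"
    using assms by (simp add: orthonormal_on_def image_subset_iff inj_on_eq_iff)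
qed

lemma orthonormal_on_norm: "orthonormal_on J g \<Longrightarrow> j \<in> J \<Longrightarrow> norm (g j) = 1"
proof -
  assume "orthonormal_on J g" "j \<in> J"
  then have "complex_of_real ((norm (g j))\<^sup>2) = complex_of_real 1"
    unfolding cinner_same[symmetric] by (simp add: orthonormal_on_def)
  then have "(norm (g j))\<^sup>2 = 1" by (simp only: of_real_eq_iff)
  then show ?thesis by (simp add: power2_eq_1_iff) (use norm_ge_zero[of "g j"] in linarith)
qed

lemma orthonormal_on_inj: "orthonormal_on J g \<Longrightarrow> inj_on g J"
  unfolding inj_on_def orthonormal_on_def by (metis zero_neq_one)

lemma cinner_orthonormal_sum:
  assumes "orthonormal_on F g" "finite F" "j \<in> F"
  shows "cinner (g j) (\<Sum>k\<in>F. scaleC (a k) (g k)) = a j"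
proof -
  have "cinner (g j) (\<Sum>k\<in>F. scaleC (a k) (g k)) = (\<Sum>k\<in>F. if k = j then a j else 0)"
    unfolding cinner_sum_right
    by (rule sum.cong) (use assms in \<open>auto simp: orthonormal_on_def cinner_scaleC_right\<close>)
  then show ?thesis using assms by simp
qed

lemma norm_orthonormal_sum:
  assumes "orthonormal_on F g" "finite F"
  shows "(norm (\<Sum>j\<in>F. scaleC (a j) (g j)))\<^sup>2 = (\<Sum>j\<in>F. (cmod (a j))\<^sup>2)"
proof -
  let ?s = "\<Sum>j\<in>F. scaleC (a j) (g j)"
  have "complex_of_real ((norm ?s)\<^sup>2) = (\<Sum>j\<in>F. cnj (a j) * cinner (g j) ?s)"
    by (simp only: cinner_same[symmetric] cinner_sum_left[of _ _ ?s] cinner_scaleC_left)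
  also have "\<dots> = (\<Sum>j\<in>F. cnj (a j) * a j)"
    using cinner_orthonormal_sum[OF assms] by simp
  also have "\<dots> = complex_of_real (\<Sum>j\<in>F. (cmod (a j))\<^sup>2)"
    by (simp add: complex_norm_square mult.commute del: of_real_power)
  finally show ?thesis by (simp only: of_real_eq_iff)
qed

text \<open>Completing the square in each coefficient. The last sum vanishes at the Fourier
  coefficients, so the identity contains Bessel's inequality as well as best approximation.\<close>

lemma norm_diff_orthonormal_sum:
  assumes F: "orthonormal_on F g" "finite F"
  shows "(norm (x - (\<Sum>j\<in>F. scaleC (a j) (g j))))\<^sup>2 =
    (norm x)\<^sup>2 - (\<Sum>j\<in>F. (cmod (cinner (g j) x))\<^sup>2) + (\<Sum>j\<in>F. (cmod (a j - cinner (g j) x))\<^sup>2)"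
proof -
  let ?s = "\<Sum>j\<in>F. scaleC (a j) (g j)"
  have "(norm (x - ?s))\<^sup>2 = (norm x)\<^sup>2 - 2 * inner ?s x + (norm ?s)\<^sup>2"
    by (simp add: power2_norm_eq_inner inner_diff_left inner_diff_right inner_commute)
  also have "inner ?s x = (\<Sum>j\<in>F. Re (cnj (a j) * cinner (g j) x))"
    by (simp only: inner_eq_Re_cinner cinner_sum_left cinner_scaleC_left Re_sum)
  also have "(norm ?s)\<^sup>2 = (\<Sum>j\<in>F. (cmod (a j))\<^sup>2)" by (rule norm_orthonormal_sum[OF F])
  also have "(norm x)\<^sup>2 - 2 * (\<Sum>j\<in>F. Re (cnj (a j) * cinner (g j) x)) + (\<Sum>j\<in>F. (cmod (a j))\<^sup>2)
     = (norm x)\<^sup>2 - (\<Sum>j\<in>F. (cmod (cinner (g j) x))\<^sup>2)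
       + (\<Sum>j\<in>F. (cmod (cinner (g j) x))\<^sup>2 - 2 * Re (cnj (a j) * cinner (g j) x) + (cmod (a j))\<^sup>2)"
    by (simp add: sum.distrib sum_subtractf sum_distrib_left)
  also have "(\<Sum>j\<in>F. (cmod (cinner (g j) x))\<^sup>2 - 2 * Re (cnj (a j) * cinner (g j) x) + (cmod (a j))\<^sup>2)
     = (\<Sum>j\<in>F. (cmod (a j - cinner (g j) x))\<^sup>2)"
    unfolding cmod_power2 by (rule sum.cong) (simp_all add: power2_eq_square algebra_simps)
  finally show ?thesis .
qed

lemma norm_diff_projection:
  assumes "orthonormal_on F g" "finite F"
  shows "(norm (x - (\<Sum>j\<in>F. scaleC (cinner (g j) x) (g j))))\<^sup>2 =
    (norm x)\<^sup>2 - (\<Sum>j\<in>F. (cmod (cinner (g j) x))\<^sup>2)"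
  by (simp add: norm_diff_orthonormal_sum[OF assms])

lemma bessel_inequality:
  assumes "orthonormal_on F g" "finite F"
  shows "(\<Sum>j\<in>F. (cmod (cinner (g j) x))\<^sup>2) \<le> (norm x)\<^sup>2"
  using norm_diff_projection[OF assms, of x] zero_le_power2 by (metis diff_ge_0_iff_ge)

text \<open>A finite combination s over F within e of x exists by density. For every finite G above
  F the Fourier partial sum is at least as close as s, since it is the best approximation and the
  Bessel sums grow with G.\<close>

lemma orthonormal_basis_has_sum:
  assumes onb: "orthonormal_basis J g"
  shows "((\<lambda>j. scaleC (cinner (g j) x) (g j)) has_sum x) J"
  unfolding has_sum_def tendsto_iff eventually_finite_subsets_at_top
proof (intro allI impI)
  note on = orthonormal_basis_orthonormal_on[OF onb]
  fix e :: real assume "e > 0"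
  have "x \<in> closure (cspan (g ` J))" using orthonormal_basis_dense[OF onb] by simp
  then obtain s where s: "s \<in> cspan (g ` J)" "dist s x < e"
    using \<open>e > 0\<close> closure_approachable by blast
  from s(1) obtain t r where t: "finite t" "t \<subseteq> g ` J" "s = (\<Sum>a\<in>t. scaleC (r a) a)"
    unfolding complex_vector.span_explicit by auto
  obtain F where F: "F \<subseteq> J" "finite F" "t = g ` F"
    using finite_subset_image[OF t(1,2)] by auto
  have sF: "s = (\<Sum>j\<in>F. scaleC (r (g j)) (g j))"
    unfolding t(3) F(3) using inj_on_subset[OF orthonormal_on_inj[OF on] F(1)]
    by (simp add: sum.reindex)
  show "\<exists>X. finite X \<and> X \<subseteq> J \<and> (\<forall>Y. finite Y \<and> X \<subseteq> Y \<and> Y \<subseteq> J \<longrightarrow>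
      dist (\<Sum>j\<in>Y. scaleC (cinner (g j) x) (g j)) x < e)"
  proof (intro exI[of _ F] conjI allI impI F)
    fix G assume G: "finite G \<and> F \<subseteq> G \<and> G \<subseteq> J"
    note onF = orthonormal_on_subset[OF on F(1)]
    have onG: "orthonormal_on G g" using orthonormal_on_subset[OF on] G by blast
    have "(norm (x - (\<Sum>j\<in>G. scaleC (cinner (g j) x) (g j))))\<^sup>2
        = (norm x)\<^sup>2 - (\<Sum>j\<in>G. (cmod (cinner (g j) x))\<^sup>2)"
      using norm_diff_projection[OF onG] G by blast
    also have "\<dots> \<le> (norm x)\<^sup>2 - (\<Sum>j\<in>F. (cmod (cinner (g j) x))\<^sup>2)"
      using G by (simp add: sum_mono2)
    also have "\<dots> \<le> (norm (x - s))\<^sup>2"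
      unfolding sF norm_diff_orthonormal_sum[OF onF F(2)] by (simp add: sum_nonneg)
    also have "\<dots> < e\<^sup>2"
      using s(2) by (intro power_strict_mono) (auto simp: dist_norm norm_minus_commute)
    finally show "dist (\<Sum>j\<in>G. scaleC (cinner (g j) x) (g j)) x < e"
      using \<open>e > 0\<close> by (simp add: dist_norm norm_minus_commute power_less_imp_less_base)
  qed
qed

text \<open>Riesz for y -> <x, y> on the span produces the projection w of x onto its closure, and x
  - w is orthogonal to the span. Testing also with -i y settles the imaginary part.\<close>

lemma orthogonal_vector_exists:
  assumes "closure (cspan E) \<noteq> (UNIV :: 'a::chilbert_space set)"
  obtains u where "u \<noteq> 0" "\<And>y. y \<in> E \<Longrightarrow> cinner u y = 0"
proof -
  obtain x where x: "x \<notin> closure (cspan E)" using assms by blast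
  have sub: "subspace (cspan E)"
    by (intro subspaceI)
       (simp_all flip: scaleC_of_real add: complex_vector.span_add complex_vector.span_scale complex_vector.span_zero)
  have "linear (\<lambda>y. inner x y)" by (intro linearI) (simp_all add: inner_add_right)
  then obtain w where w: "w \<in> closure (id ` cspan E)" "\<And>y. y \<in> cspan E \<Longrightarrow> inner w (id y) = inner x y"
    using riesz_range[of "cspan E" id "\<lambda>y. inner x y" "norm x"] sub linear_id Cauchy_Schwarz_ineq2
    by (metis id_apply)
  have "x - w \<noteq> 0" using x w(1) by auto
  moreover have "cinner (x - w) y = 0" if "y \<in> E" for y
  proof -
    have y: "y \<in> cspan E" "scaleC (-\<i>) y \<in> cspan E"
      using that by (simp_all only: complex_vector.span_base complex_vector.span_scale)
    have "Im (cinner (x - w) y) = inner (x - w) (scaleC (-\<i>) y)"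
      by (simp add: inner_eq_Re_cinner cinner_scaleC_right)
    also have "\<dots> = 0" using w(2)[OF y(2)] by (simp only: inner_diff_left id_apply)
    finally have "Im (cinner (x - w) y) = 0" .
    moreover have "Re (cinner (x - w) y) = 0"
      using w(2)[OF y(1)] by (simp add: inner_diff_left flip: inner_eq_Re_cinner)
    ultimately show ?thesis by (simp add: complex_eq_iff)
  qed
  ultimately show thesis by (rule that)
qed

text \<open>Zorn's lemma gives a maximal orthonormal set. If its span were not dense, a normalized
  orthogonal vector would enlarge it.\<close>

lemma some_basis_orthonormal_basis: "orthonormal_basis (some_basis :: 'a::chilbert_space set) (\<lambda>e. e)"
proof -
  let ?A = "{E :: 'a set. orthonormal_on E (\<lambda>e. e)}"
  have "\<exists>M\<in>?A. \<forall>X\<in>?A. M \<subseteq> X \<longrightarrow> X = M"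
  proof (rule subset_Zorn_nonempty)
    show "?A \<noteq> {}" using orthonormal_on_def by blast
    fix \<C> assume C: "\<C> \<noteq> {}" "subset.chain ?A \<C>"
    have "cinner x y = (if x = y then 1 else 0)" if "x \<in> \<Union>\<C>" "y \<in> \<Union>\<C>" for x y
    proof -
      obtain E where "E \<in> \<C>" "x \<in> E" "y \<in> E"
        using \<open>x \<in> \<Union>\<C>\<close> \<open>y \<in> \<Union>\<C>\<close> C(2) unfolding subset_chain_def by blast
      moreover have "E \<in> ?A" using \<open>E \<in> \<C>\<close> C(2) unfolding subset_chain_def by blast
      ultimately show ?thesis by (auto simp: orthonormal_on_def)
    qed
    then show "\<Union>\<C> \<in> ?A" by (auto simp: orthonormal_on_def)
  qed
  then obtain E where E: "orthonormal_on E (\<lambda>e::'a. e)"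
    and max: "\<And>X. orthonormal_on X (\<lambda>e. e) \<Longrightarrow> E \<subseteq> X \<Longrightarrow> X = E" by auto
  have "closure (cspan E) = UNIV"
  proof (rule ccontr)
    assume "closure (cspan E) \<noteq> UNIV"
    then obtain u where u: "u \<noteq> 0" "\<And>y. y \<in> E \<Longrightarrow> cinner u y = 0"
      using orthogonal_vector_exists by blast
    define v where "v = (1 / norm u) *\<^sub>R u"
    have vE: "cinner v y = 0" "cinner y v = 0" if "y \<in> E" for y
      using u(2)[OF that] cinner_commute[of y u]
      by (simp_all add: v_def cinner_scaleR_left cinner_scaleR_right)
    have vv: "cinner v v = 1"
      using u(1) by (simp add: v_def cinner_scaleR_left cinner_scaleR_right cinner_same
          scaleR_conv_of_real power2_eq_square)
    have "orthonormal_on (insert v E) (\<lambda>e. e)"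
      using E vE vv unfolding orthonormal_on_def by auto
    then have "v \<in> E" using max by blast
    then show False using vE vv by auto
  qed
  then have "orthonormal_basis E (\<lambda>e. e)"
    using E by (simp add: orthonormal_basis_def orthonormal_on_def)
  then show ?thesis unfolding some_basis_def by (rule someI)
qed

section \<open>Polar decomposition\<close>

lemma norm_abs_op:
  assumes "bounded_clinear A"
  shows "norm (abs_op A x) = norm (A x)"
proof -
  have "complex_of_real ((norm (abs_op A x))\<^sup>2) = complex_of_real ((norm (A x))\<^sup>2)"
    unfolding cinner_same[symmetric] by (rule cinner_abs_op_abs_op[OF assms])
  then show ?thesis by (simp only: of_real_eq_iff) simp
qed

lemma subspace_closure:
  fixes S :: "'a::real_normed_vector set"
  assumes S: "subspace S"
  shows "subspace (closure S)"
proof (rule subspaceI)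
  show "0 \<in> closure S" using subspace_0[OF S] closure_subset by blast
next
  fix x y assume "x \<in> closure S" "y \<in> closure S"
  then obtain a b where "\<And>n. a n \<in> S" "a \<longlonglongrightarrow> x" "\<And>n. b n \<in> S" "b \<longlonglongrightarrow> y"
    unfolding closure_sequential by metis
  then show "x + y \<in> closure S"
    unfolding closure_sequential using S
    by (intro exI[of _ "\<lambda>n. a n + b n"]) (auto intro: tendsto_add subspace_add)
next
  fix c x assume "x \<in> closure S"
  then obtain a where "\<And>n. a n \<in> S" "a \<longlonglongrightarrow> x"
    unfolding closure_sequential by metis
  then show "c *\<^sub>R x \<in> closure S"
    unfolding closure_sequential using S
    by (intro exI[of _ "\<lambda>n. c *\<^sub>R a n"]) (auto intro: tendsto_scaleR subspace_scale)
qed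

text \<open>What is built is the adjoint V of the partial isometry: V v is the vector in the closed
  range of |A| that represents |A| x -> <v, A x>, a bounded functional because norm (|A| x) = norm
  (A x). Lying in that closure makes V v unique, whence linearity. U is \<open>cadjoint V\<close>,
  and the last clause expresses V A = |A|.\<close>

lemma polar_decomposition:
  fixes A :: "'a::chilbert_space \<Rightarrow> 'a"
  assumes A: "bounded_clinear A"
  obtains U where "bounded_clinear U" "\<And>x. norm (U x) \<le> norm x" "\<And>x. U (abs_op A x) = A x"
    "\<And>x y. cinner (U x) (A y) = cinner x (abs_op A y)"
proof -
  define P where "P = abs_op A"
  have P: "bounded_clinear P" using positive_op_abs_op[OF A] by (simp add: P_def positive_op_def)
  let ?S = "closure (range P)"
  have "subspace (range P)"
    using linear_subspace_image[OF bounded_clinear_linear[OF P] subspace_UNIV] .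
  then have S: "subspace ?S" by (rule subspace_closure)
  have S_scaleC: "scaleC c y \<in> ?S" if "y \<in> ?S" for c y
  proof -
    have "scaleC c ` ?S \<subseteq> closure (scaleC c ` range P)"
      by (rule closure_bounded_linear_image_subset[OF bounded_linear_scaleC_right])
    also have "\<dots> \<subseteq> ?S"
      by (intro closure_mono) (auto simp flip: bounded_clinear_scaleC[OF P])
    finally show ?thesis using that by blast
  qed
  have "\<exists>w\<in>?S. \<forall>x. inner w (P x) = inner v (A x)" for v
  proof -
    have "linear (\<lambda>x. inner v (A x))"
      using bounded_clinear_linear[OF A]
      by (intro linearI) (simp_all add: linear_add linear_cmul inner_add_right)
    then show ?thesis
      using riesz_range[of UNIV P "\<lambda>x. inner v (A x)" "norm v"] Cauchy_Schwarz_ineq2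
        bounded_clinear_linear[OF P] norm_abs_op[OF A]
      by (metis P_def UNIV_I subspace_UNIV)
  qed
  then obtain V where VS: "\<And>v. V v \<in> ?S" and V: "\<And>v x. inner (V v) (P x) = inner v (A x)" by metis
  have orth: "inner z y = 0" if "\<And>x. inner z (P x) = 0" "y \<in> ?S" for z y
  proof -
    have "?S \<subseteq> {y. inner z y = 0}"
      using that(1) by (intro closure_minimal closed_Collect_eq continuous_intros) auto
    then show ?thesis using that(2) by blast
  qed
  have V_eqI: "V v = w" if w: "w \<in> ?S" "\<And>x. inner w (P x) = inner v (A x)" for v w
  proof -
    have "V v - w \<in> ?S" using S VS w(1) by (intro subspace_diff)
    then have "inner (V v - w) (V v - w) = 0"
      by (rule orth[rotated]) (simp add: inner_diff_left V w(2))
    then show ?thesis by simp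
  qed
  have nV: "norm (V v) \<le> norm v" for v
  proof (cases "V v = 0")
    case False
    have "?S \<subseteq> {y. inner (V v) y \<le> norm v * norm y}"
    proof (rule closure_minimal)
      show "range P \<subseteq> {y. inner (V v) y \<le> norm v * norm y}"
        using norm_cauchy_schwarz[of v] by (auto simp: V norm_abs_op[OF A, folded P_def])
      show "closed {y. inner (V v) y \<le> norm v * norm y}"
        by (intro closed_Collect_le continuous_intros)
    qed
    then have "norm (V v) * norm (V v) \<le> norm v * norm (V v)"
      using VS[of v] by (auto simp: dot_square_norm power2_eq_square)
    then show ?thesis using False by simp
  qed auto
  have Vc: "bounded_clinear V"
  proof (rule bounded_clinearI[where K = 1])
    show "V (x + y) = V x + V y" for x y
      by (intro V_eqI subspace_add S VS) (simp add: inner_add_left V)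
    show "V (scaleC c x) = scaleC c (V x)" for c x
    proof (intro V_eqI S_scaleC VS)
      fix y
      have "inner (scaleC c (V x)) (P y) = inner (V x) (P (scaleC (cnj c) y))"
        by (simp add: bounded_clinear_scaleC[OF P] inner_eq_Re_cinner cinner_scaleC_left cinner_scaleC_right)
      also have "\<dots> = inner (scaleC c x) (A y)"
        by (simp only: V) (simp add: bounded_clinear_scaleC[OF A] inner_eq_Re_cinner cinner_scaleC_left cinner_scaleC_right)
      finally show "inner (scaleC c (V x)) (P y) = inner (scaleC c x) (A y)" .
    qed
  qed (use nV in auto)
  have VA: "V (A y) = P y" for y
    using cinner_abs_op_abs_op[OF A, of y]
    by (intro V_eqI) (auto simp: P_def inner_eq_Re_cinner intro: subsetD[OF closure_subset])
  have Vcinner: "cinner (V v) (P x) = cinner v (A x)" for v x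
  proof (rule cinner_eqI_inner)
    have "inner (V (scaleC \<i> v)) (P x) = inner (scaleC \<i> v) (A x)" by (rule V)
    then show "inner (scaleC \<i> (V v)) (P x) = inner (scaleC \<i> v) (A x)"
      by (simp add: bounded_clinear_scaleC[OF Vc])
  qed (rule V)
  show thesis
  proof
    show "bounded_clinear (cadjoint V)" by (rule bounded_clinear_cadjoint[OF Vc])
    show "norm (cadjoint V x) \<le> norm x" for x
      using norm_cadjoint_le[OF Vc, of 1 x] nV by simp
    show "cadjoint V (abs_op A x) = A x" for x
      by (rule cinner_extI) (simp add: cinner_cadjoint_right[OF Vc] Vcinner flip: P_def)
    show "cinner (cadjoint V x) (A y) = cinner x (abs_op A y)" for x y
      by (simp add: cinner_cadjoint_left[OF Vc] VA P_def)
  qed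
qed

section \<open>Nuclear bounds and the trace norm\<close>

text \<open>
  \<open>u\<close> is the image of an orthonormal system under a contraction. In contrast to orthonormal systems,
  such families are stable under contractions, so that the supremum of \<open>\<Sum>\<^sub>i |\<langle>u\<^sub>i, A v\<^sub>i\<rangle>|\<close> over them
  is visibly monotone under compressions of \<open>A\<close>. This supremum turns out to be the trace norm.
\<close>

definition contractive_family :: "nat \<Rightarrow> (nat \<Rightarrow> 'a::chilbert_space) \<Rightarrow> bool" where
  "contractive_family n u \<longleftrightarrow>
     (\<forall>c. (norm (\<Sum>i<n. scaleC (c i) (u i)))\<^sup>2 \<le> (\<Sum>i<n. (cmod (c i))\<^sup>2))"

definition nuclear_bound :: "('a::chilbert_space \<Rightarrow> 'b::chilbert_space) \<Rightarrow> real \<Rightarrow> bool" where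
  "nuclear_bound A M \<longleftrightarrow> (\<forall>n u v. contractive_family n u \<longrightarrow> contractive_family n v \<longrightarrow>
     (\<Sum>i<n. cmod (cinner (u i) (A (v i)))) \<le> M)"

text \<open>Duality: the map sending c to the sum of the c_i u_i is a contraction, hence so is its
  adjoint, which sends x to the family of <u_i, x>.\<close>

lemma contractive_family_bessel:
  assumes "contractive_family n u"
  shows "(\<Sum>i<n. (cmod (cinner (u i) x))\<^sup>2) \<le> (norm x)\<^sup>2"
proof -
  let ?S = "\<Sum>i<n. (cmod (cinner (u i) x))\<^sup>2"
  let ?y = "\<Sum>i<n. scaleC (cinner (u i) x) (u i)"
  have "complex_of_real ?S = cinner ?y x"
    by (simp add: cinner_sum_left cinner_scaleC_left complex_norm_square mult.commute del: of_real_power)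
  then have "\<bar>?S\<bar> = cmod (cinner ?y x)" by (metis norm_of_real)
  moreover have "?S \<ge> 0" by (simp add: sum_nonneg)
  ultimately have "?S = cmod (cinner ?y x)" by (simp only: abs_of_nonneg)
  also have "\<dots> \<le> norm ?y * norm x" by (rule cmod_cinner_le)
  finally have "?S\<^sup>2 \<le> (norm ?y * norm x)\<^sup>2" by (intro power_mono sum_nonneg) auto
  also have "\<dots> = (norm ?y)\<^sup>2 * (norm x)\<^sup>2" by (rule power_mult_distrib)
  also have "\<dots> \<le> ?S * (norm x)\<^sup>2"
    using assms by (intro mult_right_mono) (auto simp: contractive_family_def)
  finally have "?S\<^sup>2 \<le> ?S * (norm x)\<^sup>2" .
  then have "?S * ?S \<le> ?S * (norm x)\<^sup>2" by (simp only: power2_eq_square[of ?S])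
  then show ?thesis
    using \<open>?S \<ge> 0\<close> by (metis mult_le_cancel_left_pos order_le_less zero_le_power2)
qed

lemma contractive_family_image:
  assumes u: "contractive_family n u" and W: "bounded_clinear W" "\<And>x. norm (W x) \<le> norm x"
  shows "contractive_family n (\<lambda>i. W (u i))"
  unfolding contractive_family_def
proof
  fix c
  have "(\<Sum>i<n. scaleC (c i) (W (u i))) = W (\<Sum>i<n. scaleC (c i) (u i))"
    by (simp add: linear_sum[OF bounded_clinear_linear[OF W(1)]] bounded_clinear_scaleC[OF W(1)])
  then have "(norm (\<Sum>i<n. scaleC (c i) (W (u i))))\<^sup>2 \<le> (norm (\<Sum>i<n. scaleC (c i) (u i)))\<^sup>2"
    using W(2) by (simp add: power_mono)
  also have "\<dots> \<le> (\<Sum>i<n. (cmod (c i))\<^sup>2)" using u by (auto simp: contractive_family_def)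
  finally show "(norm (\<Sum>i<n. scaleC (c i) (W (u i))))\<^sup>2 \<le> (\<Sum>i<n. (cmod (c i))\<^sup>2)" .
qed

lemma contractive_family_orthonormal:
  assumes "orthonormal_on {..<n} u"
  shows "contractive_family n u"
  by (simp add: contractive_family_def norm_orthonormal_sum[OF assms])

lemma contractive_family_single:
  assumes "norm x \<le> 1"
  shows "contractive_family 1 (\<lambda>_. x)"
proof -
  have "(norm x)\<^sup>2 \<le> 1" using assms by (simp add: power_le_one)
  then have "(cmod c)\<^sup>2 * (norm x)\<^sup>2 \<le> (cmod c)\<^sup>2" for c
    using mult_left_mono[of "(norm x)\<^sup>2" 1 "(cmod c)\<^sup>2"] by simp
  then show ?thesis by (simp add: contractive_family_def power_mult_distrib)
qed

lemma nuclear_boundI: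
  assumes "\<And>n u v. contractive_family n u \<Longrightarrow> contractive_family n v \<Longrightarrow>
    (\<Sum>i<n. cmod (cinner (u i) (A (v i)))) \<le> M"
  shows "nuclear_bound A M"
  using assms unfolding nuclear_bound_def by blast

lemma nuclear_boundD:
  "nuclear_bound A M \<Longrightarrow> contractive_family n u \<Longrightarrow> contractive_family n v \<Longrightarrow>
    (\<Sum>i<n. cmod (cinner (u i) (A (v i)))) \<le> M"
  unfolding nuclear_bound_def by blast

lemma nuclear_bound_nonneg:
  assumes "nuclear_bound A M"
  shows "M \<ge> 0"
proof -
  have "contractive_family 0 u" for u :: "nat \<Rightarrow> 'c::chilbert_space"
    by (simp add: contractive_family_def)
  from nuclear_boundD[OF assms this this] show ?thesis by simp
qed

lemma nuclear_bound_mono: "nuclear_bound A M \<Longrightarrow> M \<le> N \<Longrightarrow> nuclear_bound A N"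
  unfolding nuclear_bound_def by (meson order_trans)

lemma nuclear_bound_add:
  fixes A B :: "'a::chilbert_space \<Rightarrow> 'b::chilbert_space"
  assumes "nuclear_bound A M" "nuclear_bound B N"
  shows "nuclear_bound (\<lambda>x. A x + B x) (M + N)"
proof (rule nuclear_boundI)
  fix n and u :: "nat \<Rightarrow> 'b" and v :: "nat \<Rightarrow> 'a"
  assume uv: "contractive_family n u" "contractive_family n v"
  have "(\<Sum>i<n. cmod (cinner (u i) (A (v i) + B (v i))))
    \<le> (\<Sum>i<n. cmod (cinner (u i) (A (v i))) + cmod (cinner (u i) (B (v i))))"
    by (intro sum_mono) (simp add: cinner_add_right norm_triangle_ineq)
  also have "\<dots> \<le> M + N"
    using nuclear_boundD[OF assms(1) uv] nuclear_boundD[OF assms(2) uv] by (simp add: sum.distrib)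
  finally show "(\<Sum>i<n. cmod (cinner (u i) (A (v i) + B (v i)))) \<le> M + N" .
qed

lemma nuclear_bound_scale:
  assumes "nuclear_bound A M"
  shows "nuclear_bound (\<lambda>x. scaleC c (A x)) (cmod c * M)"
  using nuclear_boundD[OF assms]
  by (intro nuclear_boundI)
     (simp add: cinner_scaleC_right norm_mult sum_distrib_left[symmetric] mult_left_mono)

lemma nuclear_bound_zero: "nuclear_bound (\<lambda>x. 0) 0"
  by (simp add: nuclear_bound_def)

lemma nuclear_bound_sum:
  assumes "\<And>i. i \<in> I \<Longrightarrow> nuclear_bound (A i) (M i)"
  shows "nuclear_bound (\<lambda>x. \<Sum>i\<in>I. A i x) (\<Sum>i\<in>I. M i)"
  using assms
  by (induction I rule: infinite_finite_induct) (auto intro: nuclear_bound_zero nuclear_bound_add)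

text \<open>One-element families of normalized vectors already see the operator norm.\<close>

lemma nuclear_bound_norm:
  assumes A: "nuclear_bound A M" "bounded_clinear A"
  shows "norm (A x) \<le> M * norm x"
proof (cases "x = 0 \<or> A x = 0")
  case True
  then show ?thesis
    using nuclear_bound_nonneg[OF A(1)] linear_0[OF bounded_clinear_linear[OF A(2)]] by auto
next
  case False
  let ?u = "(1 / norm (A x)) *\<^sub>R A x" and ?v = "(1 / norm x) *\<^sub>R x"
  have "contractive_family 1 (\<lambda>_. ?u)" "contractive_family 1 (\<lambda>_. ?v)"
    using False by (intro contractive_family_single; simp)+
  from nuclear_boundD[OF A(1) this] have "cmod (cinner ?u (A ?v)) \<le> M" by simp
  also have "cinner ?u (A ?v) = norm (A x) / norm x"
    using False linear_cmul[OF bounded_clinear_linear[OF A(2)], of "1 / norm x" x]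
    by (simp add: cinner_scaleR_left cinner_scaleR_right cinner_same scaleR_conv_of_real power2_eq_square)
  finally show ?thesis using False by (simp add: norm_divide field_simps)
qed

text \<open>The last assumption says that B is the adjoint of V, after A, after W. Both the
  embedding of an operator as |a><b| \<otimes> B and the extraction of blocks of an operator on the
  tensor product have this shape.\<close>

lemma nuclear_bound_compress:
  assumes A: "nuclear_bound A M"
    and V: "bounded_clinear V" "\<And>x. norm (V x) \<le> norm x"
    and W: "bounded_clinear W" "\<And>x. norm (W x) \<le> norm x"
    and B: "\<And>x y. cinner x (B y) = cinner (V x) (A (W y))"
  shows "nuclear_bound B M"
  using nuclear_boundD[OF A contractive_family_image[OF _ V] contractive_family_image[OF _ W]]
  by (intro nuclear_boundI) (simp add: B)

text \<open>Each test sum is a sum of products |<u_i, x>| |<v_i, y>|; Cauchy-Schwarz separates the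
  factors and Bessel bounds each one.\<close>

lemma nuclear_bound_ketbra:
  fixes x :: "'b::chilbert_space" and y :: "'a::chilbert_space"
  shows "nuclear_bound (ketbra x y) (norm x * norm y)"
proof (rule nuclear_boundI)
  fix n and u :: "nat \<Rightarrow> 'b" and v :: "nat \<Rightarrow> 'a"
  assume uv: "contractive_family n u" "contractive_family n v"
  have "(\<Sum>i<n. cmod (cinner (u i) (ketbra x y (v i))))
      = (\<Sum>i<n. \<bar>cmod (cinner (u i) x)\<bar> * \<bar>cmod (cinner (v i) y)\<bar>)"
    by (intro sum.cong)
       (auto simp: ketbra_def cinner_scaleC_right norm_mult cinner_commute[of y] mult.commute)
  also have "\<dots> \<le> L2_set (\<lambda>i. cmod (cinner (u i) x)) {..<n} * L2_set (\<lambda>i. cmod (cinner (v i) y)) {..<n}"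
    by (rule L2_set_mult_ineq)
  also have "\<dots> \<le> norm x * norm y"
    using contractive_family_bessel[OF uv(1), of x] contractive_family_bessel[OF uv(2), of y]
    by (intro mult_mono) (auto simp: L2_set_def sum_nonneg intro: real_le_lsqrt)
  finally show "(\<Sum>i<n. cmod (cinner (u i) (ketbra x y (v i)))) \<le> norm x * norm y" .
qed

lemma bounded_clinear_ketbra: "bounded_clinear (ketbra x y)"
proof (rule bounded_clinearI[where K = "norm x * norm y"])
  show "norm (ketbra x y z) \<le> norm x * norm y * norm z" for z
    using mult_left_mono[OF cmod_cinner_le[of y z] norm_ge_zero[of x]]
    by (simp add: ketbra_def mult.commute[of _ "norm x"] mult.assoc)
  show "ketbra x y (z + w) = ketbra x y z + ketbra x y w" for z w
    by (simp only: ketbra_def cinner_add_right scaleC_add_left)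
  show "ketbra x y (scaleC c z) = scaleC c (ketbra x y z)" for c z
    by (simp only: ketbra_def cinner_scaleC_right scaleC_scaleC)
qed

text \<open>Test sums are finite, hence continuous along the net of partial sums, and their bound
  passes to the limit. Because pointwise convergence suffices, operators can be defined pointwise
  first and estimated afterwards.\<close>

lemma nuclear_bound_has_sum:
  fixes A :: "'i \<Rightarrow> 'a::chilbert_space \<Rightarrow> 'b::chilbert_space"
  assumes A: "\<And>i. i \<in> I \<Longrightarrow> nuclear_bound (A i) (M i)" and M: "(M has_sum S) I"
    and T: "\<And>x. ((\<lambda>i. A i x) has_sum T x) I"
  shows "nuclear_bound T S"
proof (rule nuclear_boundI)
  fix n and u :: "nat \<Rightarrow> 'b" and v :: "nat \<Rightarrow> 'a"
  assume uv: "contractive_family n u" "contractive_family n v"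
  have lim: "((\<lambda>F. \<Sum>i<n. cmod (cinner (u i) (\<Sum>j\<in>F. A j (v i)))) \<longlongrightarrow>
      (\<Sum>i<n. cmod (cinner (u i) (T (v i))))) (finite_subsets_at_top I)"
    using T unfolding has_sum_def by (intro tendsto_intros)
  have "eventually (\<lambda>F. (\<Sum>i<n. cmod (cinner (u i) (\<Sum>j\<in>F. A j (v i)))) \<le> S) (finite_subsets_at_top I)"
  proof (rule eventually_finite_subsets_at_top_weakI)
    fix F assume F: "finite F" "F \<subseteq> I"
    have "(\<Sum>i<n. cmod (cinner (u i) (\<Sum>j\<in>F. A j (v i)))) \<le> sum M F"
      using A F by (intro nuclear_boundD[OF nuclear_bound_sum uv]) auto
    also have "\<dots> \<le> S"
      using F A by (intro finite_sum_le_has_sum[OF M]) (auto dest: nuclear_bound_nonneg)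
    finally show "(\<Sum>i<n. cmod (cinner (u i) (\<Sum>j\<in>F. A j (v i)))) \<le> S" .
  qed
  then show "(\<Sum>i<n. cmod (cinner (u i) (T (v i)))) \<le> S"
    using lim by (intro tendsto_upperbound) auto
qed

section \<open>Nuclear bounds characterize trace class and trace norm\<close>

lemma cinner_abs_op_real:
  assumes "bounded_clinear A"
  shows "cinner x (abs_op A x) = complex_of_real (Re (cinner x (abs_op A x)))"
    and "Re (cinner x (abs_op A x)) \<ge> 0"
proof -
  have "cinner x (abs_op A x) \<in> \<real>\<^sub>\<ge>\<^sub>0"
    using positive_op_abs_op[OF assms] by (simp add: positive_op_def)
  then have "Re (cinner x (abs_op A x)) \<ge> 0" "Im (cinner x (abs_op A x)) = 0"
    by (simp_all add: complex_nonneg_Reals_iff)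
  then show "cinner x (abs_op A x) = complex_of_real (Re (cinner x (abs_op A x)))"
    and "Re (cinner x (abs_op A x)) \<ge> 0"
    by (simp_all add: complex_eq_iff)
qed

text \<open>Test with v_i = e_i from the basis and u_i = U e_i from the polar decomposition: <U e, A
  e> = <e, |A| e>, so the partial sums of the trace of |A| stay below M. The U e_i need not be
  orthonormal, but they form a contractive family.\<close>

lemma nuclear_bound_trace_class:
  assumes A: "bounded_clinear A" and M: "nuclear_bound A M"
  shows "trace_class A" "trace_norm A \<le> M"
proof -
  obtain U where U: "bounded_clinear U" "\<And>x. norm (U x) \<le> norm x" "\<And>x y. cinner (U x) (A y) = cinner x (abs_op A y)"
    using polar_decomposition[OF A] by metis
  let ?f = "\<lambda>e. Re (cinner e (abs_op A e))"
  have fin: "sum ?f F \<le> M" if F: "finite F" "F \<subseteq> some_basis" for F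
  proof -
    obtain h where h: "bij_betw h {..<card F} F"
      using ex_bij_betw_nat_finite[OF F(1)] by (auto simp: atLeast0LessThan)
    have "orthonormal_on F (\<lambda>e. e)"
      using orthonormal_basis_orthonormal_on[OF some_basis_orthonormal_basis] F(2)
      by (rule orthonormal_on_subset)
    then have "orthonormal_on {..<card F} h"
      using orthonormal_on_reindex[of F "\<lambda>e. e" h "{..<card F}"] h by (auto simp: bij_betw_def)
    then have "contractive_family (card F) h" by (rule contractive_family_orthonormal)
    from nuclear_boundD[OF M contractive_family_image[OF this U(1,2)] this]
    have "(\<Sum>i<card F. cmod (cinner (h i) (abs_op A (h i)))) \<le> M" by (simp add: U(3))
    moreover have "sum ?f F = (\<Sum>i<card F. ?f (h i))"
      using sum.reindex_bij_betw[OF h, of ?f] by simp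
    moreover have "(\<Sum>i<card F. ?f (h i)) \<le> (\<Sum>i<card F. cmod (cinner (h i) (abs_op A (h i))))"
      by (intro sum_mono complex_Re_le_cmod)
    ultimately show ?thesis by linarith
  qed
  have summ: "?f summable_on some_basis"
    using fin cinner_abs_op_real(2)[OF A]
    by (intro nonneg_bdd_above_summable_on bdd_aboveI[of _ M]) auto
  then have hs: "((\<lambda>e. cinner e (abs_op A e)) has_sum complex_of_real (infsum ?f some_basis)) some_basis"
    using has_sum_of_real[OF has_sum_infsum[OF summ], where 'a = complex]
    by (simp only: cinner_abs_op_real(1)[OF A, symmetric])
  then show "trace_class A"
    using A by (auto simp: trace_class_def dest: has_sum_imp_summable)
  have "trace_norm A = infsum ?f some_basis"
    using infsumI[OF hs] by (simp add: trace_norm_def)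
  also have "\<dots> \<le> M" using summ fin by (rule infsum_le_finite_sums)
  finally show "trace_norm A \<le> M" .
qed

text \<open>
  With \<open>A = U |A|\<close> and \<open>R = \<surd>|A|\<close> one has \<open>A = \<Sum>\<^sub>e |U R e\<rangle>\<langle>R e|\<close>, and \<open>\<parallel>R e\<parallel>\<^sup>2 = \<langle>e, |A| e\<rangle>\<close>.
\<close>

lemma trace_class_expansion:
  fixes A :: "'a::chilbert_space \<Rightarrow> 'a"
  assumes "trace_class A"
  obtains a b :: "'a \<Rightarrow> 'a" and m :: "'a \<Rightarrow> real" where
    "\<And>e. norm (a e) * norm (b e) \<le> m e" "(m has_sum trace_norm A) some_basis"
    "\<And>x. ((\<lambda>e. ketbra (a e) (b e) x) has_sum A x) some_basis"
proof -
  have A: "bounded_clinear A" and summ: "(\<lambda>e. cinner e (abs_op A e)) summable_on some_basis"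
    using assms by (auto simp: trace_class_def)
  obtain U where U: "bounded_clinear U" "\<And>x. norm (U x) \<le> norm x" "\<And>x. U (abs_op A x) = A x"
    using polar_decomposition[OF A] by metis
  obtain R where R: "positive_op R" "\<And>x. R (R x) = abs_op A x"
    using positive_op_sqrt[OF positive_op_abs_op[OF A]] by blast
  let ?m = "\<lambda>e. Re (cinner e (abs_op A e))"
  show thesis
  proof
    show "norm (U (R e)) * norm (R e) \<le> ?m e" for e
    proof -
      have "?m e = (norm (R e))\<^sup>2"
        by (simp add: cinner_same flip: R(2) positive_op_symmetric[OF R(1)])
      then show ?thesis using mult_right_mono[OF U(2)[of "R e"], of "norm (R e)"]
        by (simp add: power2_eq_square)
    qed
    show "(?m has_sum trace_norm A) some_basis"
      unfolding trace_norm_def using summ by (intro has_sum_Re has_sum_infsum)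
    fix x
    have "bounded_linear (\<lambda>x. U (R x))"
      using bounded_linear_compose U(1) R(1)
      by (auto simp: positive_op_def bounded_clinear_def)
    from has_sum_bounded_linear[OF this orthonormal_basis_has_sum[OF some_basis_orthonormal_basis, of "R x"]]
    show "((\<lambda>e. ketbra (U (R e)) (R e) x) has_sum A x) some_basis"
      using U R by (simp add: ketbra_def positive_op_symmetric[OF R(1)] positive_op_def bounded_clinear_scaleC comp_def)
  qed
qed

lemma trace_class_bounded_clinear: "trace_class A \<Longrightarrow> bounded_clinear A"
  by (simp add: trace_class_def)

text \<open>Converse of \<open>nuclear_bound_trace_class\<close>: the rank-one terms of the
  expansion have nuclear bounds that add up to the trace norm. Together they make the trace norm the
  least nuclear bound.\<close>

lemma trace_class_nuclear_bound:
  assumes "trace_class A"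
  shows "nuclear_bound A (trace_norm A)"
proof -
  obtain a b :: "'a \<Rightarrow> 'a" and m :: "'a \<Rightarrow> real" where
    ab: "\<And>e. norm (a e) * norm (b e) \<le> m e" and m: "(m has_sum trace_norm A) some_basis"
    and exp: "\<And>x. ((\<lambda>e. ketbra (a e) (b e) x) has_sum A x) some_basis"
    using trace_class_expansion[OF assms] by blast
  show ?thesis
    by (rule nuclear_bound_has_sum[OF nuclear_bound_mono[OF nuclear_bound_ketbra ab] m exp])
qed

section \<open>Trace-class operators as a normed vector space\<close>

lemma trace_norm_nonneg: "trace_class A \<Longrightarrow> trace_norm A \<ge> 0"
  by (rule nuclear_bound_nonneg[OF trace_class_nuclear_bound])

lemma norm_le_trace_norm: "trace_class A \<Longrightarrow> norm (A x) \<le> trace_norm A * norm x"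
  by (intro nuclear_bound_norm trace_class_nuclear_bound trace_class_bounded_clinear)

lemma trace_class_add:
  assumes "trace_class A" "trace_class B"
  shows "trace_class (\<lambda>x. A x + B x)"
  by (rule nuclear_bound_trace_class[OF bounded_clinear_add nuclear_bound_add,
    OF assms[THEN trace_class_bounded_clinear] assms[THEN trace_class_nuclear_bound]])

lemma trace_class_scale:
  assumes "trace_class A"
  shows "trace_class (\<lambda>x. scaleC c (A x))"
  by (rule nuclear_bound_trace_class[OF bounded_clinear_scale nuclear_bound_scale,
    OF trace_class_bounded_clinear trace_class_nuclear_bound, OF assms assms])

lemma trace_class_diff: "trace_class A \<Longrightarrow> trace_class B \<Longrightarrow> trace_class (\<lambda>x. A x - B x)"
  using trace_class_add[of A "\<lambda>x. scaleC (-1) (B x)"] trace_class_scale[of B "-1"] by simp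

lemma trace_class_zero: "trace_class (\<lambda>x. 0)"
  by (rule nuclear_bound_trace_class[OF bounded_clinear_zero nuclear_bound_zero])

lemma trace_class_sum:
  "(\<And>i. i \<in> I \<Longrightarrow> trace_class (A i)) \<Longrightarrow> trace_class (\<lambda>x. \<Sum>i\<in>I. A i x)"
  by (induction I rule: infinite_finite_induct) (simp_all add: trace_class_zero trace_class_add)

lemma trace_class_ketbra: "trace_class (ketbra x y)"
  and trace_norm_ketbra: "trace_norm (ketbra x y) \<le> norm x * norm y"
  by (rule nuclear_bound_trace_class[OF bounded_clinear_ketbra nuclear_bound_ketbra])+

section \<open>Absolutely convergent families in trace norm\<close>

lemma has_trace_norm_sumI:
  assumes A: "\<And>i. i \<in> I \<Longrightarrow> bounded_clinear (A i)" "\<And>i. i \<in> I \<Longrightarrow> nuclear_bound (A i) (M i)"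
    and M: "M summable_on I" and T: "\<And>x. ((\<lambda>i. A i x) has_sum T x) I"
  shows "has_trace_norm_sum A T I"
proof -
  have Tb: "nuclear_bound T (infsum M I)"
    by (rule nuclear_bound_has_sum[OF A(2) has_sum_infsum[OF M] T])
  have AT: "bounded_clinear T"
  proof -
    have nT: "norm (T x) \<le> infsum M I * norm x" for x
    proof -
      have 1: "((\<lambda>i. M i * norm x) has_sum (infsum M I * norm x)) I"
        using M by (intro has_sum_cmult_left has_sum_infsum)
      have 2: "norm (A i x) \<le> M i * norm x" if "i \<in> I" for i
        using that A by (intro nuclear_bound_norm)
      show ?thesis by (rule norm_infsum_le[OF T 1 2])
    qed
    show ?thesis
    proof (rule bounded_clinearI[OF _ _ nT])
      fix x y
      have "((\<lambda>i. A i (x + y)) has_sum T x + T y) I"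
        using has_sum_add[OF T[of x] T[of y]]
        by (rule has_sum_cong[THEN iffD1, rotated]) (simp add: linear_add[OF bounded_clinear_linear] A(1))
      then show "T (x + y) = T x + T y" using T has_sum_unique by blast
    next
      fix c x
      have "((\<lambda>i. A i (scaleC c x)) has_sum scaleC c (T x)) I"
        using has_sum_bounded_linear[OF bounded_linear_scaleC_right[of c] T[of x]]
        by (rule has_sum_cong[THEN iffD1, rotated]) (simp add: bounded_clinear_scaleC A(1))
      then show "T (scaleC c x) = scaleC c (T x)" using T has_sum_unique by blast
    qed
  qed
  \<comment> \<open>T minus a partial sum over F is itself the sum of the family over I - F, so its
    trace norm is at most the tail of the bounds M.\<close>
  have le: "trace_norm (\<lambda>x. (\<Sum>i\<in>F. A i x) - T x) \<le> infsum M I - sum M F" 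
    and nn: "trace_norm (\<lambda>x. (\<Sum>i\<in>F. A i x) - T x) \<ge> 0" if F: "finite F" "F \<subseteq> I" for F
  proof -
    have MF: "(M has_sum (infsum M I - sum M F)) (I - F)"
      using M F by (intro has_sum_Diff) auto
    have TF: "((\<lambda>i. A i x) has_sum (T x - (\<Sum>i\<in>F. A i x))) (I - F)" for x
      using T F by (intro has_sum_Diff) auto
    have "nuclear_bound (\<lambda>x. T x - (\<Sum>i\<in>F. A i x)) (infsum M I - sum M F)"
      by (rule nuclear_bound_has_sum[OF A(2) MF TF]) auto
    then have nb: "nuclear_bound (\<lambda>x. (\<Sum>i\<in>F. A i x) - T x) (infsum M I - sum M F)"
      using nuclear_bound_scale[of "\<lambda>x. T x - (\<Sum>i\<in>F. A i x)" _ "-1"] by simp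
    have bc: "bounded_clinear (\<lambda>x. (\<Sum>i\<in>F. A i x) - T x)"
      using A(1) F AT by (intro bounded_clinear_sub bounded_clinear_sum) auto
    show "trace_norm (\<lambda>x. (\<Sum>i\<in>F. A i x) - T x) \<le> infsum M I - sum M F"
      and "trace_norm (\<lambda>x. (\<Sum>i\<in>F. A i x) - T x) \<ge> 0"
      using nuclear_bound_trace_class[OF bc nb] trace_norm_nonneg by auto
  qed
  have "((\<lambda>F. infsum M I - sum M F) \<longlongrightarrow> infsum M I - infsum M I) (finite_subsets_at_top I)"
    using has_sum_infsum[OF M] unfolding has_sum_def by (intro tendsto_intros)
  then have lim: "((\<lambda>F. infsum M I - sum M F) \<longlongrightarrow> 0) (finite_subsets_at_top I)" by simp
  have "((\<lambda>F. trace_norm (\<lambda>x. (\<Sum>i\<in>F. A i x) - T x)) \<longlongrightarrow> 0) (finite_subsets_at_top I)"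
    by (rule tendsto_sandwich[OF _ _ tendsto_const lim])
       (auto intro!: eventually_finite_subsets_at_top_weakI le nn)
  then show ?thesis
    using nuclear_bound_trace_class[OF AT Tb] by (simp add: has_trace_norm_sum_def)
qed

text \<open>Completeness enters through the Hilbert space: the family converges absolutely at each
  vector, and the pointwise sum is then upgraded to a sum in trace norm.\<close>

lemma nuclear_summable:
  fixes A :: "'i \<Rightarrow> 'a::chilbert_space \<Rightarrow> 'a"
  assumes A: "\<And>i. i \<in> I \<Longrightarrow> bounded_clinear (A i)" "\<And>i. i \<in> I \<Longrightarrow> nuclear_bound (A i) (M i)"
    and M: "M summable_on I"
  obtains T where "\<And>x. ((\<lambda>i. A i x) has_sum T x) I" "has_trace_norm_sum A T I"
proof -
  define T where "T x = infsum (\<lambda>i. A i x) I" for x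
  have T: "((\<lambda>i. A i x) has_sum T x) I" for x
  proof -
    have "(\<lambda>i. norm (A i x)) summable_on I"
    proof (rule Infinite_Sum.abs_summable_on_comparison_test')
      show "(\<lambda>i. M i * norm x) summable_on I" using M by (rule summable_on_cmult_left)
      show "norm (A i x) \<le> M i * norm x" if "i \<in> I" for i
        using A(2)[OF that] A(1)[OF that] by (rule nuclear_bound_norm)
    qed
    from has_sum_infsum[OF abs_summable_summable[OF this]] show ?thesis unfolding T_def .
  qed
  from T has_trace_norm_sumI[OF A M T] show thesis by (rule that)
qed

text \<open>The trace norm dominates the operator norm. Limits in trace norm are therefore unique,
  as the \<open>THE\<close> in \<open>choi_map\<close> demands.\<close>

lemma has_trace_norm_sum_pointwise:
  assumes A: "\<And>i. i \<in> I \<Longrightarrow> trace_class (A i)" and T: "has_trace_norm_sum A T I"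
  shows "((\<lambda>i. A i x) has_sum T x) I"
proof -
  have "trace_class T" and lim: "((\<lambda>F. trace_norm (\<lambda>x. (\<Sum>i\<in>F. A i x) - T x)) \<longlongrightarrow> 0) (finite_subsets_at_top I)"
    using T by (auto simp: has_trace_norm_sum_def)
  have "((\<lambda>F. (\<Sum>i\<in>F. A i x) - T x) \<longlongrightarrow> 0) (finite_subsets_at_top I)"
  proof (rule Lim_null_comparison)
    show "eventually (\<lambda>F. norm ((\<Sum>i\<in>F. A i x) - T x)
      \<le> trace_norm (\<lambda>x. (\<Sum>i\<in>F. A i x) - T x) * norm x) (finite_subsets_at_top I)"
      using A \<open>trace_class T\<close>
      by (intro eventually_finite_subsets_at_top_weakI
            norm_le_trace_norm[of "\<lambda>x. (\<Sum>i\<in>F. A i x) - T x" for F] trace_class_diff trace_class_sum) auto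
    show "((\<lambda>F. trace_norm (\<lambda>x. (\<Sum>i\<in>F. A i x) - T x) * norm x) \<longlongrightarrow> 0) (finite_subsets_at_top I)"
      using tendsto_mult_right[OF lim, of "norm x"] by simp
  qed
  then show ?thesis unfolding has_sum_def by (simp add: LIM_zero_iff)
qed

lemma trace_class_has_trace_norm_sum:
  fixes A :: "'a::chilbert_space \<Rightarrow> 'a"
  assumes "trace_class A"
  obtains a b :: "'a \<Rightarrow> 'a" where "has_trace_norm_sum (\<lambda>e. ketbra (a e) (b e)) A some_basis"
proof -
  obtain a b :: "'a \<Rightarrow> 'a" and m :: "'a \<Rightarrow> real" where
    ab: "\<And>e. norm (a e) * norm (b e) \<le> m e" and m: "(m has_sum trace_norm A) some_basis"
    and exp: "\<And>x. ((\<lambda>e. ketbra (a e) (b e) x) has_sum A x) some_basis"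
    using trace_class_expansion[OF assms] by blast
  have "has_trace_norm_sum (\<lambda>e. ketbra (a e) (b e)) A some_basis"
    by (rule has_trace_norm_sumI[OF bounded_clinear_ketbra nuclear_bound_mono[OF nuclear_bound_ketbra ab]
          has_sum_imp_summable[OF m] exp])
  then show thesis by (rule that)
qed

section \<open>Bounded maps between trace classes\<close>

lemma bounded_trace_class_mapsE:
  assumes "\<Phi> \<in> bounded_trace_class_maps"
  obtains K where "K \<ge> 0" "\<And>A. trace_class A \<Longrightarrow> trace_norm (\<Phi> A) \<le> K * trace_norm A"
proof -
  obtain K where K: "\<And>A. trace_class A \<Longrightarrow> trace_norm (\<Phi> A) \<le> K * trace_norm A"
    using assms unfolding bounded_trace_class_maps_def by blast
  have "trace_norm (\<Phi> A) \<le> max K 0 * trace_norm A" if "trace_class A" for A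
    using K[OF that] mult_right_mono[of K "max K 0" "trace_norm A"] trace_norm_nonneg[OF that] by linarith
  then show thesis by (intro that[of "max K 0"]) auto
qed

lemma
  assumes "\<Phi> \<in> bounded_trace_class_maps"
  shows btc_trace_class: "trace_class A \<Longrightarrow> trace_class (\<Phi> A)"
    and btc_add: "trace_class A \<Longrightarrow> trace_class B \<Longrightarrow> \<Phi> (\<lambda>x. A x + B x) = (\<lambda>z. \<Phi> A z + \<Phi> B z)"
    and btc_scaleC: "trace_class A \<Longrightarrow> \<Phi> (\<lambda>x. scaleC c (A x)) = (\<lambda>z. scaleC c (\<Phi> A z))"
  using assms unfolding bounded_trace_class_maps_def by (blast dest: PiE_mem)+

lemma btc_zero: "\<Phi> \<in> bounded_trace_class_maps \<Longrightarrow> \<Phi> (\<lambda>x. 0) = (\<lambda>z. 0)"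
  using btc_scaleC[of \<Phi> "\<lambda>x. 0" 0] trace_class_zero by simp

lemma btc_sum:
  assumes \<Phi>: "\<Phi> \<in> bounded_trace_class_maps" and A: "\<And>i. i \<in> I \<Longrightarrow> trace_class (A i)"
  shows "\<Phi> (\<lambda>x. \<Sum>i\<in>I. scaleC (c i) (A i x)) = (\<lambda>z. \<Sum>i\<in>I. scaleC (c i) (\<Phi> (A i) z))"
  using A
proof (induction I rule: infinite_finite_induct)
  case (insert i I)
  then show ?case
    by (simp add: btc_add[OF \<Phi>] btc_scaleC[OF \<Phi>] trace_class_scale trace_class_sum)
qed (simp_all add: btc_zero[OF \<Phi>])

lemma btc_diff:
  assumes \<Phi>: "\<Phi> \<in> bounded_trace_class_maps" and AB: "trace_class A" "trace_class B"
  shows "\<Phi> (\<lambda>x. A x - B x) = (\<lambda>z. \<Phi> A z - \<Phi> B z)"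
  using btc_add[OF \<Phi> AB(1) trace_class_scale[OF AB(2), of "-1"]] btc_scaleC[OF \<Phi> AB(2), of "-1"]
  by simp

lemma btc_norm_le:
  assumes \<Phi>: "\<Phi> \<in> bounded_trace_class_maps"
    and K: "\<And>A. trace_class A \<Longrightarrow> trace_norm (\<Phi> A) \<le> K * trace_norm A" and A: "trace_class A"
  shows "norm (\<Phi> A z) \<le> K * trace_norm A * norm z"
  using order_trans[OF norm_le_trace_norm[OF btc_trace_class[OF \<Phi> A]] mult_right_mono[OF K[OF A]]] by simp

text \<open>A coefficient matrix of product form collapses to a single rank-one operator, whose
  trace norm is known; \<open>choi_map_quadratic_le\<close> rests on this.\<close>

lemma ketbra_sum:
  assumes "finite F"
  shows "ketbra (\<Sum>j\<in>F. scaleC (a j) (g j)) (\<Sum>k\<in>F. scaleC (b k) (g k)) w =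
    (\<Sum>(j, k)\<in>F \<times> F. scaleC (a j * cnj (b k)) (ketbra (g j) (g k) w))"
proof -
  have "(\<Sum>(j, k)\<in>F \<times> F. scaleC (a j * cnj (b k)) (ketbra (g j) (g k) w))
     = (\<Sum>j\<in>F. \<Sum>k\<in>F. scaleC (cnj (b k) * cinner (g k) w) (scaleC (a j) (g j)))"
    by (simp add: sum.cartesian_product ketbra_def mult_ac)
  also have "\<dots> = (\<Sum>j\<in>F. scaleC (\<Sum>k\<in>F. cnj (b k) * cinner (g k) w) (scaleC (a j) (g j)))"
    by (simp only: complex_vector.scale_sum_left)
  also have "\<dots> = ketbra (\<Sum>j\<in>F. scaleC (a j) (g j)) (\<Sum>k\<in>F. scaleC (b k) (g k)) w"
    by (simp only: complex_vector.scale_sum_right[symmetric] ketbra_def cinner_sum_left cinner_scaleC_left)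
  finally show ?thesis by simp
qed

text \<open>
  Sums of rank-one operators are dense in trace norm, and rank-one operators are approximated by
  combinations of the \<open>|g\<^sub>j\<rangle>\<langle>g\<^sub>k|\<close>.
\<close>

lemma btc_eqI:
  fixes \<Phi> \<Psi> :: "('a::chilbert_space \<Rightarrow> 'a) \<Rightarrow> ('b::chilbert_space \<Rightarrow> 'b)"
  assumes \<Phi>: "\<Phi> \<in> bounded_trace_class_maps" and \<Psi>: "\<Psi> \<in> bounded_trace_class_maps"
    and onb: "orthonormal_basis J g"
    and eq: "\<And>j k. j \<in> J \<Longrightarrow> k \<in> J \<Longrightarrow> \<Phi> (ketbra (g j) (g k)) = \<Psi> (ketbra (g j) (g k))"
  shows "\<Phi> = \<Psi>"
proof -
  obtain K where K: "K \<ge> 0" "\<And>A. trace_class A \<Longrightarrow> trace_norm (\<Phi> A) \<le> K * trace_norm A"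
    using bounded_trace_class_mapsE[OF \<Phi>] by blast
  obtain L where L: "L \<ge> 0" "\<And>A. trace_class A \<Longrightarrow> trace_norm (\<Psi> A) \<le> L * trace_norm A"
    using bounded_trace_class_mapsE[OF \<Psi>] by blast
  \<comment> \<open>The filter is left arbitrary because the claim is needed along sequences, for
    closedness, and along the net of finite subsets of the basis.\<close>
  have limit: "\<Phi> A = \<Psi> A" if A: "trace_class A"
    and lim: "(f \<longlongrightarrow> 0) net" "net \<noteq> bot"
    and B: "eventually (\<lambda>n. trace_class (B n) \<and> \<Phi> (B n) = \<Psi> (B n) \<and>
        trace_norm (\<lambda>x. B n x - A x) \<le> f n) net"
    for A net and f :: "'x \<Rightarrow> real" and B :: "'x \<Rightarrow> 'a \<Rightarrow> 'a"
  proof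
    fix z
    have "eventually (\<lambda>n. norm (\<Phi> A z - \<Psi> A z) \<le> (K + L) * f n * norm z) net"
      using B
    proof eventually_elim
      case (elim n)
      let ?D = "\<lambda>x. B n x - A x"
      have D: "trace_class ?D" using elim A trace_class_diff by blast
      have "\<Phi> A z - \<Psi> A z = \<Psi> ?D z - \<Phi> ?D z"
        using elim A by (simp add: btc_diff[OF \<Phi>] btc_diff[OF \<Psi>])
      then have "norm (\<Phi> A z - \<Psi> A z) \<le> norm (\<Psi> ?D z) + norm (\<Phi> ?D z)"
        by (simp add: norm_triangle_ineq4)
      also have "\<dots> \<le> (K + L) * trace_norm ?D * norm z"
        using btc_norm_le[OF \<Psi> L(2) D, of z] btc_norm_le[OF \<Phi> K(2) D, of z]
        by (simp add: distrib_right)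
      also have "\<dots> \<le> (K + L) * f n * norm z"
        using elim K(1) L(1) by (intro mult_right_mono mult_left_mono) auto
      finally show ?case .
    qed
    moreover have "((\<lambda>n. (K + L) * f n * norm z) \<longlongrightarrow> (K + L) * 0 * norm z) net"
      by (intro tendsto_intros lim)
    ultimately have "norm (\<Phi> A z - \<Psi> A z) \<le> (K + L) * 0 * norm z"
      using lim(2) by (intro tendsto_lowerbound)
    then show "\<Phi> A z = \<Psi> A z" by simp
  qed
  have cl: "closed {x. \<Phi> (H x) = \<Psi> (H x)}"
    if H: "\<And>x. trace_class (H x)" "\<And>x y. trace_norm (\<lambda>w. H x w - H y w) \<le> c * norm (x - y)"
    for H :: "'a \<Rightarrow> 'a \<Rightarrow> 'a" and c
    unfolding closed_sequential_limits
  proof (intro allI impI)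
    fix x l assume xl: "(\<forall>n. x n \<in> {x. \<Phi> (H x) = \<Psi> (H x)}) \<and> x \<longlonglongrightarrow> l"
    have "(\<lambda>n. c * norm (x n - l)) \<longlonglongrightarrow> c * norm (l - l)"
      using xl by (intro tendsto_intros) auto
    then have "\<Phi> (H l) = \<Psi> (H l)"
      using xl H by (intro limit[of "H l" "\<lambda>n. c * norm (x n - l)" sequentially "\<lambda>n. H (x n)"]) auto
    then show "l \<in> {x. \<Phi> (H x) = \<Psi> (H x)}" by simp
  qed
  have right: "\<Phi> (ketbra (g j) y) = \<Psi> (ketbra (g j) y)" if "j \<in> J" for j y
  proof -
    let ?V = "{y. \<Phi> (ketbra (g j) y) = \<Psi> (ketbra (g j) y)}"
    have "complex_vector.subspace ?V"
    proof (rule complex_vector.subspaceI)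
      show "0 \<in> ?V" using btc_zero[OF \<Phi>] btc_zero[OF \<Psi>] by (simp add: ketbra_def)
      fix x y assume *: "x \<in> ?V" "y \<in> ?V"
      have "ketbra (g j) (x + y) = (\<lambda>w. ketbra (g j) x w + ketbra (g j) y w)"
        by (simp add: ketbra_def cinner_add_left scaleC_add_left)
      then show "x + y \<in> ?V"
        using * by (simp add: btc_add[OF \<Phi>] btc_add[OF \<Psi>] trace_class_ketbra)
    next
      fix c x assume *: "x \<in> ?V"
      have "ketbra (g j) (scaleC c x) = (\<lambda>w. scaleC (cnj c) (ketbra (g j) x w))"
        by (simp add: ketbra_def cinner_scaleC_left)
      then show "scaleC c x \<in> ?V"
        using * by (simp add: btc_scaleC[OF \<Phi>] btc_scaleC[OF \<Psi>] trace_class_ketbra)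
    qed
    moreover have "closed ?V"
    proof (rule cl[OF trace_class_ketbra])
      fix x y :: 'a
      have "(\<lambda>w. ketbra (g j) x w - ketbra (g j) y w) = ketbra (g j) (x - y)"
        by (simp add: ketbra_def cinner_diff_left complex_vector.scale_left_diff_distrib)
      then show "trace_norm (\<lambda>w. ketbra (g j) x w - ketbra (g j) y w) \<le> norm (g j) * norm (x - y)"
        by (simp add: trace_norm_ketbra)
    qed
    ultimately have "y \<in> ?V"
      using eq[OF that] by (intro closed_subspace_eq_UNIV[OF orthonormal_basis_dense[OF onb]]) auto
    then show ?thesis by simp
  qed
  have ket: "\<Phi> (ketbra x y) = \<Psi> (ketbra x y)" for x y
  proof -
    let ?V = "{x. \<Phi> (ketbra x y) = \<Psi> (ketbra x y)}"
    have "complex_vector.subspace ?V"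
    proof (rule complex_vector.subspaceI)
      show "0 \<in> ?V" using btc_zero[OF \<Phi>] btc_zero[OF \<Psi>] by (simp add: ketbra_def)
      fix x x' assume *: "x \<in> ?V" "x' \<in> ?V"
      have "ketbra (x + x') y = (\<lambda>w. ketbra x y w + ketbra x' y w)"
        by (simp add: ketbra_def scaleC_add_right)
      then show "x + x' \<in> ?V"
        using * by (simp add: btc_add[OF \<Phi>] btc_add[OF \<Psi>] trace_class_ketbra)
    next
      fix c x assume *: "x \<in> ?V"
      have "ketbra (scaleC c x) y = (\<lambda>w. scaleC c (ketbra x y w))"
        by (simp add: ketbra_def mult.commute)
      then show "scaleC c x \<in> ?V"
        using * by (simp add: btc_scaleC[OF \<Phi>] btc_scaleC[OF \<Psi>] trace_class_ketbra)
    qed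
    moreover have "closed ?V"
    proof (rule cl[OF trace_class_ketbra])
      fix x x' :: 'a
      have "(\<lambda>w. ketbra x y w - ketbra x' y w) = ketbra (x - x') y"
        by (simp add: ketbra_def complex_vector.scale_right_diff_distrib)
      then show "trace_norm (\<lambda>w. ketbra x y w - ketbra x' y w) \<le> norm y * norm (x - x')"
        using trace_norm_ketbra[of "x - x'" y] by (simp add: mult.commute)
    qed
    ultimately have "x \<in> ?V"
      using right by (intro closed_subspace_eq_UNIV[OF orthonormal_basis_dense[OF onb]]) auto
    then show ?thesis by simp
  qed
  have tc: "\<Phi> A = \<Psi> A" if A: "trace_class A" for A
  proof -
    obtain a b :: "'a \<Rightarrow> 'a" where ab: "has_trace_norm_sum (\<lambda>e. ketbra (a e) (b e)) A some_basis"
      using trace_class_has_trace_norm_sum[OF A] by blast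
    have S: "trace_class (\<lambda>x. \<Sum>e\<in>F. ketbra (a e) (b e) x) \<and>
        \<Phi> (\<lambda>x. \<Sum>e\<in>F. ketbra (a e) (b e) x) = \<Psi> (\<lambda>x. \<Sum>e\<in>F. ketbra (a e) (b e) x)" for F
      using btc_sum[OF \<Phi>, of F "\<lambda>e. ketbra (a e) (b e)" "\<lambda>_. 1"]
        btc_sum[OF \<Psi>, of F "\<lambda>e. ketbra (a e) (b e)" "\<lambda>_. 1"]
      by (simp add: trace_class_ketbra trace_class_sum ket)
    have lim: "((\<lambda>F. trace_norm (\<lambda>x. (\<Sum>e\<in>F. ketbra (a e) (b e) x) - A x)) \<longlongrightarrow> 0)
        (finite_subsets_at_top some_basis)"
      using ab unfolding has_trace_norm_sum_def by blast
    show ?thesis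
      by (rule limit[OF A lim finite_subsets_at_top_neq_bot,
            where B = "\<lambda>F x. \<Sum>e\<in>F. ketbra (a e) (b e) x"]) (simp add: S)
  qed
  \<comment> \<open>Outside the trace class both maps are \<open>undefined\<close>, so agreement on
    trace-class operators is equality.\<close>
  show ?thesis
  proof (rule PiE_ext)
    show "\<Phi> \<in> Collect trace_class \<rightarrow>\<^sub>E Collect trace_class" "\<Psi> \<in> Collect trace_class \<rightarrow>\<^sub>E Collect trace_class"
      using \<Phi> \<Psi> unfolding bounded_trace_class_maps_def by blast+
  qed (use tc in auto)
qed

section \<open>Tensor products\<close>

lemma subspace_closure_cspan: "complex_vector.subspace (closure (cspan S))"
proof (rule complex_vector.subspaceI)
  show "0 \<in> closure (cspan S)" using complex_vector.span_zero closure_subset by blast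
next
  fix x y assume "x \<in> closure (cspan S)" "y \<in> closure (cspan S)"
  then obtain a b where "\<And>n. a n \<in> cspan S" "a \<longlonglongrightarrow> x" "\<And>n. b n \<in> cspan S" "b \<longlonglongrightarrow> y"
    unfolding closure_sequential by metis
  then show "x + y \<in> closure (cspan S)"
    unfolding closure_sequential
    by (intro exI[of _ "\<lambda>n. a n + b n"]) (auto intro: tendsto_add complex_vector.span_add)
next
  fix c x assume "x \<in> closure (cspan S)"
  then obtain a where "\<And>n. a n \<in> cspan S" "a \<longlonglongrightarrow> x"
    unfolding closure_sequential by metis
  then show "scaleC c x \<in> closure (cspan S)"
    unfolding closure_sequential
    by (intro exI[of _ "\<lambda>n. scaleC c (a n)"]) (auto intro: tendsto_intros complex_vector.span_scale)
qed

context
  fixes tens :: "'h::chilbert_space \<Rightarrow> 'z::chilbert_space \<Rightarrow> 'k::chilbert_space"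
  assumes tens: "hilbert_tensor tens"
begin

lemma tens_add_left: "tens (x + x') y = tens x y + tens x' y"
  and tens_add_right: "tens x (y + y') = tens x y + tens x y'"
  and tens_scaleC_left: "tens (scaleC c x) y = scaleC c (tens x y)"
  and tens_scaleC_right: "tens x (scaleC c y) = scaleC c (tens x y)"
  and cinner_tens: "cinner (tens x y) (tens x' y') = cinner x x' * cinner y y'"
  and tens_dense: "closure (cspan {tens x y | x y. True}) = UNIV"
  using tens unfolding hilbert_tensor_def by blast+

lemma norm_tens: "norm (tens x y) = norm x * norm y"
proof -
  have "complex_of_real ((norm (tens x y))\<^sup>2) = complex_of_real ((norm x * norm y)\<^sup>2)"
    unfolding cinner_same[symmetric] cinner_tens by (simp add: cinner_same power_mult_distrib)
  then have "(norm (tens x y))\<^sup>2 = (norm x * norm y)\<^sup>2" by (simp only: of_real_eq_iff)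
  then show ?thesis by (simp add: power2_eq_iff_nonneg)
qed

lemma bounded_clinear_tens_right: "bounded_clinear (tens x)"
  by (rule bounded_clinearI[OF tens_add_right tens_scaleC_right, where K = "norm x"]) (simp add: norm_tens)

lemma bounded_clinear_tens_left: "bounded_clinear (\<lambda>x. tens x y)"
  by (rule bounded_clinearI[OF tens_add_left tens_scaleC_left, where K = "norm y"])
     (simp add: norm_tens)

lemma cadjoint_tens: "cadjoint (tens b) (tens x y) = scaleC (cinner b x) y"
  by (rule cinner_extI)
     (simp add: cinner_cadjoint_right[OF bounded_clinear_tens_right] cinner_tens cinner_scaleC_right)

lemma norm_cadjoint_tens_le: "norm b \<le> 1 \<Longrightarrow> norm (cadjoint (tens b) v) \<le> norm v"
  using norm_cadjoint_le[OF bounded_clinear_tens_right, of b 1 v]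
  by (simp add: norm_tens mult_left_le_one_le)

lemma tensor_op_eqI:
  assumes "bounded_clinear T" "\<And>x y. T (tens x y) = tens (A x) (B y)"
  shows "tensor_op tens A B = T"
  unfolding tensor_op_def
proof (rule the_equality)
  fix S assume "bounded_clinear S \<and> (\<forall>x y. S (tens x y) = tens (A x) (B y))"
  then show "S = T" using assms by (intro bounded_clinear_ext[OF tens_dense]) auto
qed (use assms in blast)

text \<open>With a rank-one left factor the tensor operator factors explicitly: contract with b,
  apply B, tensor with a. This supplies the existence that the \<open>THE\<close> in
  \<open>tensor_op\<close> asks for, and exhibits a compression of B.\<close>

lemma tensor_op_ketbra:
  assumes B: "bounded_clinear B"
  shows "tensor_op tens (ketbra a b) B = (\<lambda>v. tens a (B (cadjoint (tens b) v)))"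
proof (rule tensor_op_eqI)
  show "bounded_clinear (\<lambda>v. tens a (B (cadjoint (tens b) v)))"
    by (intro bounded_clinear_compose[OF bounded_clinear_tens_right]
        bounded_clinear_compose[OF B] bounded_clinear_cadjoint bounded_clinear_tens_right)
  show "tens a (B (cadjoint (tens b) (tens x y))) = tens (ketbra a b x) (B y)" for x y
    by (simp add: cadjoint_tens ketbra_def bounded_clinear_scaleC[OF B] tens_scaleC_left tens_scaleC_right)
qed

lemma tensor_op_ketbra_tens:
  "bounded_clinear B \<Longrightarrow> tensor_op tens (ketbra a b) B (tens x y) = scaleC (cinner b x) (tens a (B y))"
  by (simp add: tensor_op_ketbra cadjoint_tens bounded_clinear_scaleC tens_scaleC_right)

lemma
  assumes B: "trace_class B" and ab: "norm a \<le> 1" "norm b \<le> 1"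
  shows trace_class_tensor_op_ketbra: "trace_class (tensor_op tens (ketbra a b) B)"
    and nuclear_bound_tensor_op_ketbra: "nuclear_bound (tensor_op tens (ketbra a b) B) (trace_norm B)"
proof -
  have bc: "bounded_clinear B" by (rule trace_class_bounded_clinear[OF B])
  show nb: "nuclear_bound (tensor_op tens (ketbra a b) B) (trace_norm B)"
    unfolding tensor_op_ketbra[OF bc]
    by (rule nuclear_bound_compress[OF trace_class_nuclear_bound[OF B],
          of "cadjoint (tens a)" "cadjoint (tens b)"])
       (simp_all add: ab norm_cadjoint_tens_le bounded_clinear_cadjoint bounded_clinear_tens_right
          cinner_cadjoint_left[OF bounded_clinear_tens_right])
  have "bounded_clinear (tensor_op tens (ketbra a b) B)"
    unfolding tensor_op_ketbra[OF bc]
    by (intro bounded_clinear_compose[OF bounded_clinear_tens_right]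
        bounded_clinear_compose[OF bc] bounded_clinear_cadjoint bounded_clinear_tens_right)
  then show "trace_class (tensor_op tens (ketbra a b) B)"
    using nb by (rule nuclear_bound_trace_class)
qed

text \<open>The density principle is applied twice: for fixed y to pass from the g_j to all x, then
  to pass from elementary tensors to the whole space.\<close>

lemma tens_basis_dense:
  assumes onb: "orthonormal_basis J g"
  shows "closure (cspan {tens (g j) y | j y. j \<in> J}) = UNIV"
proof -
  let ?S = "{tens (g j) y | j y. j \<in> J}"
  have sub: "complex_vector.subspace (closure (cspan ?S))" by (rule subspace_closure_cspan)
  have "tens x y \<in> closure (cspan ?S)" for x y
  proof -
    let ?V = "{x. tens x y \<in> closure (cspan ?S)}"
    have "complex_vector.subspace ?V"
      using sub linear_0[OF bounded_clinear_linear[OF bounded_clinear_tens_left]]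
      by (intro complex_vector.subspaceI)
         (auto simp: tens_add_left tens_scaleC_left complex_vector.subspace_0
           complex_vector.subspace_add complex_vector.subspace_scale)
    moreover have "closed ?V"
      using closed_vimage[OF closed_closure
          linear_continuous_on[OF bounded_clinear_bounded_linear[OF bounded_clinear_tens_left]]]
      by (simp add: vimage_def)
    moreover have "g ` J \<subseteq> ?V"
      using closure_subset complex_vector.span_base[of _ ?S] by blast
    ultimately have "x \<in> ?V"
      by (intro closed_subspace_eq_UNIV[OF orthonormal_basis_dense[OF onb]])
    then show ?thesis by simp
  qed
  then have "\<And>v. v \<in> closure (cspan ?S)"
    using sub by (intro closed_subspace_eq_UNIV[OF tens_dense]) auto
  then show ?thesis by blast
qed

section \<open>The Choi-type map\<close>

text \<open>If K bounds Phi, the (j, k) term has nuclear bound |lambda_j| |lambda_k| K because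
  |g_j><g_k| has trace norm at most 1. The product family is summable over J \<times> J.\<close>

lemma
  fixes lam :: "'j \<Rightarrow> complex"
  assumes onb: "orthonormal_basis J g" and lam: "(\<lambda>j. norm (lam j)) summable_on J"
    and \<Phi>: "\<Phi> \<in> bounded_trace_class_maps"
  shows trace_class_choi_map: "trace_class (choi_map tens J lam g \<Phi>)"
    and choi_map_has_sum: "((\<lambda>(j, k). scaleC (cnj (lam j) * lam k)
      (tensor_op tens (ketbra (g j) (g k)) (\<Phi> (ketbra (g j) (g k))) v))
        has_sum choi_map tens J lam g \<Phi> v) (J \<times> J)"
proof -
  note on = orthonormal_basis_orthonormal_on[OF onb]
  obtain K where K: "K \<ge> 0" "\<And>A. trace_class A \<Longrightarrow> trace_norm (\<Phi> A) \<le> K * trace_norm A"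
    using bounded_trace_class_mapsE[OF \<Phi>] by blast
  let ?t = "\<lambda>j k. tensor_op tens (ketbra (g j) (g k)) (\<Phi> (ketbra (g j) (g k)))"
  define t where "t = (\<lambda>(j, k) v. scaleC (cnj (lam j) * lam k) (?t j k v))"
  define M where "M = (\<lambda>(j, k). cmod (lam j) * (cmod (lam k) * K))"
  have t: "trace_class (t i) \<and> nuclear_bound (t i) (M i)" if iJ: "i \<in> J \<times> J" for i
  proof -
    obtain j k where i: "i = (j, k)" "j \<in> J" "k \<in> J" using iJ by blast
    have n: "norm (g j) = 1" "norm (g k) = 1" using i orthonormal_on_norm[OF on] by auto
    note tc = btc_trace_class[OF \<Phi> trace_class_ketbra[of "g j" "g k"]]
    have "trace_norm (\<Phi> (ketbra (g j) (g k))) \<le> K * trace_norm (ketbra (g j) (g k))"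
      by (rule K(2)[OF trace_class_ketbra])
    also have "\<dots> \<le> K * 1"
      using trace_norm_ketbra[of "g j" "g k"] n K(1) by (intro mult_left_mono) auto
    finally have "trace_norm (\<Phi> (ketbra (g j) (g k))) \<le> K" by simp
    then have "nuclear_bound (?t j k) K"
      using nuclear_bound_mono[OF nuclear_bound_tensor_op_ketbra[OF tc]] n by auto
    from nuclear_bound_scale[OF this, of "cnj (lam j) * lam k"]
    have "nuclear_bound (t i) (M i)" by (simp add: t_def M_def i norm_mult mult.assoc)
    moreover have "trace_class (t i)"
      unfolding t_def i prod.case using n by (intro trace_class_scale trace_class_tensor_op_ketbra[OF tc]) auto
    ultimately show ?thesis by blast
  qed
  have M: "M summable_on J \<times> J"
  proof (rule summable_on_SigmaI)
    show "((\<lambda>k. M (j, k)) has_sum cmod (lam j) * (infsum (\<lambda>k. cmod (lam k)) J * K)) J" for j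
      unfolding M_def prod.case using lam by (intro has_sum_cmult_left has_sum_cmult_right has_sum_infsum)
    show "(\<lambda>j. cmod (lam j) * (infsum (\<lambda>k. cmod (lam k)) J * K)) summable_on J"
      using lam by (rule summable_on_cmult_left)
  qed (auto simp: M_def K(1))
  have tb: "bounded_clinear (t i)" "nuclear_bound (t i) (M i)" if "i \<in> J \<times> J" for i
    using t[OF that] by (auto intro: trace_class_bounded_clinear)
  obtain T where T: "\<And>v. ((\<lambda>i. t i v) has_sum T v) (J \<times> J)" and hT: "has_trace_norm_sum t T (J \<times> J)"
    using nuclear_summable[OF tb M] by blast
  have "choi_map tens J lam g \<Phi> = T"
    unfolding choi_map_def t_def[symmetric]
  proof (rule the_equality[where P = "\<lambda>T. has_trace_norm_sum t T (J \<times> J)", OF hT])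
    fix S assume "has_trace_norm_sum t S (J \<times> J)"
    then have "((\<lambda>i. t i v) has_sum S v) (J \<times> J)" for v
      using t by (intro has_trace_norm_sum_pointwise) auto
    then show "S = T" using T has_sum_unique by blast
  qed
  then show "trace_class (choi_map tens J lam g \<Phi>)"
    and "((\<lambda>(j, k). scaleC (cnj (lam j) * lam k) (?t j k v)) has_sum choi_map tens J lam g \<Phi> v) (J \<times> J)"
    using hT T[of v] by (auto simp: has_trace_norm_sum_def t_def case_prod_unfold)
qed

lemma choi_map_cinner_has_sum:
  fixes lam :: "'j \<Rightarrow> complex"
  assumes "orthonormal_basis J g" "(\<lambda>j. norm (lam j)) summable_on J" and \<Phi>: "\<Phi> \<in> bounded_trace_class_maps"
  shows "((\<lambda>(j, k). cnj (lam j) * lam k * (cinner x (g j) * cinner (g k) y *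
      cinner z (\<Phi> (ketbra (g j) (g k)) w))) has_sum
        cinner (tens x z) (choi_map tens J lam g \<Phi> (tens y w))) (J \<times> J)"
  using has_sum_bounded_linear[OF bounded_linear_cinner_right choi_map_has_sum[OF assms], of "tens x z" "tens y w"]
  by (simp add: case_prod_unfold comp_def tensor_op_ketbra_tens[OF trace_class_bounded_clinear[OF
        btc_trace_class[OF \<Phi> trace_class_ketbra]]] cinner_scaleC_right cinner_tens mult_ac)

lemma choi_map_matrix_entry:
  fixes lam :: "'j \<Rightarrow> complex"
  assumes onb: "orthonormal_basis J g" and lam: "(\<lambda>j. norm (lam j)) summable_on J"
    and \<Phi>: "\<Phi> \<in> bounded_trace_class_maps" and jk: "j \<in> J" "k \<in> J"
  shows "cinner (tens (g j) z) (choi_map tens J lam g \<Phi> (tens (g k) w)) =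
    cnj (lam j) * lam k * cinner z (\<Phi> (ketbra (g j) (g k)) w)"
proof (rule has_sum_unique[OF choi_map_cinner_has_sum[OF onb lam \<Phi>]])
  have "cinner (g a) (g b) = (if a = b then 1 else 0)" if "a \<in> J" "b \<in> J" for a b
    using orthonormal_basis_orthonormal_on[OF onb] that by (auto simp: orthonormal_on_def)
  then show "((\<lambda>(a, b). cnj (lam a) * lam b * (cinner (g j) (g a) * cinner (g b) (g k) *
      cinner z (\<Phi> (ketbra (g a) (g b)) w))) has_sum
        cnj (lam j) * lam k * cinner z (\<Phi> (ketbra (g j) (g k)) w)) (J \<times> J)"
    using jk by (intro has_sum_finite_neutralI[of "{(j, k)}"]) (auto split: if_splits)
qed

text \<open>Over a square F \<times> F the partial sum equals <z, Phi(|y><y|) z>, where y has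
  coefficients cnj(lambda_j) <x, g_j>, so it is at most K (norm y)^2 (norm z)^2. The constant c has
  to dominate |lambda_j| only where x has a component along g_j, which lets x avoid the large
  lambda_j.\<close>

lemma choi_map_quadratic_le:
  fixes lam :: "'j \<Rightarrow> complex"
  assumes onb: "orthonormal_basis J g" and lam: "(\<lambda>j. norm (lam j)) summable_on J"
    and \<Phi>: "\<Phi> \<in> bounded_trace_class_maps"
    and K: "K \<ge> 0" "\<And>A. trace_class A \<Longrightarrow> trace_norm (\<Phi> A) \<le> K * trace_norm A"
    and c: "c \<ge> 0" "\<And>j. j \<in> J \<Longrightarrow> cmod (lam j) * cmod (cinner (g j) x) \<le> c * cmod (cinner (g j) x)"
  shows "cmod (cinner (tens x z) (choi_map tens J lam g \<Phi> (tens x z))) \<le> K * (c * norm x)\<^sup>2 * (norm z)\<^sup>2"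
proof -
  define f where "f = (\<lambda>(j, k). cnj (lam j) * lam k * (cinner x (g j) * cinner (g k) x *
      cinner z (\<Phi> (ketbra (g j) (g k)) z)))"
  let ?C = "cinner (tens x z) (choi_map tens J lam g \<Phi> (tens x z))"
  have f: "(f has_sum ?C) (J \<times> J)"
    unfolding f_def by (rule choi_map_cinner_has_sum[OF onb lam \<Phi>])
  have square: "cmod (sum f (F \<times> F)) \<le> K * (c * norm x)\<^sup>2 * (norm z)\<^sup>2" if F: "finite F" "F \<subseteq> J" for F
  proof -
    define a where "a j = cnj (lam j) * cinner x (g j)" for j
    define y where "y = (\<Sum>j\<in>F. scaleC (a j) (g j))"
    have onF: "orthonormal_on F g"
      using orthonormal_on_subset[OF orthonormal_basis_orthonormal_on[OF onb] F(2)] .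
    have ca: "cnj (a k) = lam k * cinner (g k) x" for k
      by (simp add: a_def cinner_commute[of "g k" x])
    have "\<Phi> (ketbra y y) = \<Phi> (\<lambda>w. \<Sum>i\<in>F \<times> F. scaleC (a (fst i) * cnj (a (snd i))) (ketbra (g (fst i)) (g (snd i)) w))"
      unfolding y_def by (rule arg_cong[of _ _ \<Phi>]) (rule ext, simp add: ketbra_sum[OF F(1)] case_prod_unfold)
    also have "\<dots> = (\<lambda>w. \<Sum>i\<in>F \<times> F. scaleC (a (fst i) * cnj (a (snd i))) (\<Phi> (ketbra (g (fst i)) (g (snd i))) w))"
      by (rule btc_sum[OF \<Phi> trace_class_ketbra])
    finally have "cinner z (\<Phi> (ketbra y y) z) = sum f (F \<times> F)"
      by (simp add: cinner_sum_right cinner_scaleC_right f_def ca case_prod_unfold) (simp add: a_def mult_ac)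
    moreover have "cmod (cinner z (\<Phi> (ketbra y y) z)) \<le> K * (norm y)\<^sup>2 * (norm z)\<^sup>2"
    proof -
      have "norm (\<Phi> (ketbra y y) z) \<le> K * trace_norm (ketbra y y) * norm z"
        by (rule btc_norm_le[OF \<Phi> K(2) trace_class_ketbra])
      also have "\<dots> \<le> K * (norm y * norm y) * norm z"
        using K(1) by (intro mult_right_mono mult_left_mono trace_norm_ketbra) auto
      finally have "norm z * norm (\<Phi> (ketbra y y) z) \<le> norm z * (K * (norm y * norm y) * norm z)"
        by (rule mult_left_mono) simp
      then show ?thesis
        using cmod_cinner_le[of z "\<Phi> (ketbra y y) z"] by (simp add: power2_eq_square mult_ac)
    qed
    moreover have "(norm y)\<^sup>2 \<le> (c * norm x)\<^sup>2"
    proof -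
      have "(norm y)\<^sup>2 = (\<Sum>j\<in>F. (cmod (lam j) * cmod (cinner (g j) x))\<^sup>2)"
        unfolding y_def norm_orthonormal_sum[OF onF F(1)]
        by (simp add: a_def norm_mult cinner_commute[of x])
      also have "\<dots> \<le> (\<Sum>j\<in>F. c\<^sup>2 * (cmod (cinner (g j) x))\<^sup>2)"
        using c F by (intro sum_mono) (auto simp flip: power_mult_distrib intro!: power_mono)
      also have "\<dots> \<le> c\<^sup>2 * (norm x)\<^sup>2"
        unfolding sum_distrib_left[symmetric]
        by (intro mult_left_mono bessel_inequality[OF onF F(1)]) simp
      finally show ?thesis by (simp add: power_mult_distrib)
    qed
    then have "K * (norm y)\<^sup>2 * (norm z)\<^sup>2 \<le> K * (c * norm x)\<^sup>2 * (norm z)\<^sup>2"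
      using K(1) by (intro mult_right_mono mult_left_mono) auto
    ultimately show ?thesis by simp
  qed
  show ?thesis
  proof (rule field_le_epsilon)
    fix e :: real assume "e > 0"
    then obtain X where X: "finite X" "X \<subseteq> J \<times> J"
      and close: "\<And>Y. finite Y \<Longrightarrow> X \<subseteq> Y \<Longrightarrow> Y \<subseteq> J \<times> J \<Longrightarrow> dist (sum f Y) ?C < e"
      using f unfolding has_sum_def tendsto_iff eventually_finite_subsets_at_top by meson
    \<comment> \<open>Squares are cofinal among the finite subsets of J \<times> J, so the bound on
      squares suffices.\<close>
    let ?F = "fst ` X \<union> snd ` X"
    have F: "finite ?F" "?F \<subseteq> J" "X \<subseteq> ?F \<times> ?F" using X by force+
    then have "dist (sum f (?F \<times> ?F)) ?C < e" by (intro close) auto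
    then have "cmod ?C < cmod (sum f (?F \<times> ?F)) + e"
      using norm_triangle_ineq2[of ?C "sum f (?F \<times> ?F)"] by (simp add: dist_norm norm_minus_commute)
    then show "cmod ?C \<le> K * (c * norm x)\<^sup>2 * (norm z)\<^sup>2 + e"
      using square[OF F(1,2)] by linarith
  qed
qed

end

section \<open>Dimension and separability\<close>

lemma orthonormal_independent:
  assumes "orthonormal_on J g"
  shows "\<not> complex_vector.dependent (g ` J)"
proof
  assume "complex_vector.dependent (g ` J)"
  then obtain t u v where t: "finite t" "t \<subseteq> g ` J" "(\<Sum>w\<in>t. scaleC (u w) w) = 0" "v \<in> t" "u v \<noteq> 0"
    unfolding complex_vector.dependent_explicit by blast
  have "orthonormal_on t (\<lambda>e. e)"
    unfolding orthonormal_on_def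
  proof (intro ballI)
    fix x y assume "x \<in> t" "y \<in> t"
    then obtain a b where "a \<in> J" "x = g a" "b \<in> J" "y = g b" using t(2) by blast
    then show "cinner x y = (if x = y then 1 else 0)"
      using assms orthonormal_on_inj[OF assms] by (simp add: orthonormal_on_def inj_on_eq_iff)
  qed
  from cinner_orthonormal_sum[OF this t(1,4), of u] t(3,5) show False by simp
qed

lemma cfinite_dim_finite_basis:
  fixes g :: "'j \<Rightarrow> 'a::chilbert_space"
  assumes "cfinite_dim TYPE('a)" "orthonormal_on J g"
  shows "finite J"
proof -
  obtain B :: "'a set" where "finite B" "cspan B = UNIV" using assms(1) by (auto simp: cfinite_dim_def)
  then have "finite (g ` J)"
    using complex_vector.independent_span_bound[OF _ orthonormal_independent[OF assms(2)], of B] by simp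
  then show ?thesis using orthonormal_on_inj[OF assms(2)] by (simp add: finite_image_iff)
qed

lemma finite_basis_cfinite_dim:
  fixes g :: "'j \<Rightarrow> 'a::chilbert_space"
  assumes onb: "orthonormal_basis J g" and J: "finite J"
  shows "cfinite_dim TYPE('a)"
proof -
  have "x \<in> cspan (g ` J)" for x
  proof -
    have "x = (\<Sum>j\<in>J. scaleC (cinner (g j) x) (g j))"
      by (rule has_sum_unique[OF orthonormal_basis_has_sum[OF onb] has_sum_finite[OF J]])
    also have "\<dots> \<in> cspan (g ` J)"
      by (intro complex_vector.span_sum complex_vector.span_scale complex_vector.span_base imageI)
    finally show ?thesis .
  qed
  then show ?thesis using J by (auto simp: cfinite_dim_def)
qed

text \<open>The countable dense set consists of finite combinations with coefficients in Q + iQ,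
  coded as lists of triples (p, q, s).\<close>

lemma separable_space_cspan:
  fixes S :: "'a::chilbert_space set"
  assumes S: "countable S" "closure (cspan S) = UNIV"
  shows "separable_space (euclidean :: 'a topology)"
proof -
  let ?f = "\<lambda>(p, q, s). scaleC (Complex p q) s"
  define C where "C = (\<lambda>l. sum_list (map ?f l)) ` lists (\<rat> \<times> \<rat> \<times> S)"
  have "countable C"
    unfolding C_def using S(1) by (intro countable_image countable_lists countable_SIGMA countable_rat)
  have "x \<in> closure C" if "x \<in> cspan S" for x
    using that
  proof (induction rule: complex_vector.span_induct_alt)
    case base
    have "sum_list (map ?f []) \<in> C" unfolding C_def by (rule imageI) simp
    then show ?case using closure_subset by auto
  next
    case (step c s y)
    show ?case
      unfolding closure_approachable
    proof (intro allI impI)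
      fix e :: real assume "e > 0"
      \<comment> \<open>Real and imaginary parts are each off by at most d, hence the coefficient by
        2 d, and 2 d (norm s + 1) = e / 2. The added 1 allows for s = 0.\<close>
      define d where "d = e / (4 * (norm s + 1))"
      have "d > 0" using \<open>e > 0\<close> by (simp add: d_def add_nonneg_pos)
      obtain y' where y': "y' \<in> C" "dist y' y < e / 2"
        using step(2) \<open>e > 0\<close> unfolding closure_approachable by (meson half_gt_zero)
      obtain p where p: "p \<in> \<rat>" "Re c < p" "p < Re c + d"
        using Rats_dense_in_real[of "Re c" "Re c + d"] \<open>d > 0\<close> by auto
      obtain q where q: "q \<in> \<rat>" "Im c < q" "q < Im c + d"
        using Rats_dense_in_real[of "Im c" "Im c + d"] \<open>d > 0\<close> by auto
      obtain l where l: "l \<in> lists (\<rat> \<times> \<rat> \<times> S)" "y' = sum_list (map ?f l)"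
        using y'(1) unfolding C_def by blast
      have "scaleC (Complex p q) s + y' \<in> C"
        unfolding C_def
        by (rule image_eqI[of _ _ "(p, q, s) # l"]) (use l p q step(1) in auto)
      moreover have "dist (scaleC (Complex p q) s + y') (scaleC c s + y) < e"
      proof -
        have "cmod (Complex p q - c) \<le> 2 * d"
          using cmod_le[of "Complex p q - c"] p q by simp
        then have "cmod (Complex p q - c) * norm s \<le> 2 * d * norm s"
          by (rule mult_right_mono) simp
        also have "\<dots> \<le> 2 * d * (norm s + 1)"
          using \<open>d > 0\<close> by simp
        also have "\<dots> = e / 2" by (simp add: d_def divide_simps) (use norm_ge_zero[of s] in linarith)
        finally have "norm (scaleC (Complex p q - c) s) \<le> e / 2" by simp
        moreover have "scaleC (Complex p q) s + y' - (scaleC c s + y) = scaleC (Complex p q - c) s + (y' - y)"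
          by (simp add: complex_vector.scale_left_diff_distrib)
        then have "dist (scaleC (Complex p q) s + y') (scaleC c s + y)
            \<le> norm (scaleC (Complex p q - c) s) + norm (y' - y)"
          unfolding dist_norm by (simp only: norm_triangle_ineq)
        ultimately show ?thesis
          using y'(2) unfolding dist_norm by linarith
      qed
      ultimately show "\<exists>w\<in>C. dist w (scaleC c s + y) < e" by blast
    qed
  qed
  then have "closure (cspan S) \<subseteq> closure C" by (intro closure_minimal) auto
  then have "closure C = UNIV" using S(2) by auto
  then show ?thesis
    unfolding separable_space_def using \<open>countable C\<close> by (intro exI[of _ C]) simp
qed

text \<open>The n vectors e_m, projected to the span of fewer than n vectors h_j, become linearly
  dependent; the same coefficients applied to the e_m give a nonzero vector with zero
  projection.\<close>

lemma orthogonal_combination_exists: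
  fixes e :: "nat \<Rightarrow> 'a::chilbert_space" and h :: "'j \<Rightarrow> 'a"
  assumes e: "orthonormal_on {..<n} e" and h: "orthonormal_on F h" and F: "finite F" "card F < n"
  obtains c where "(\<Sum>m<n. scaleC (c m) (e m)) \<noteq> 0"
    "\<And>j. j \<in> F \<Longrightarrow> cinner (h j) (\<Sum>m<n. scaleC (c m) (e m)) = 0"
proof -
  define p where "p m = (\<Sum>j\<in>F. scaleC (cinner (h j) (e m)) (h j))" for m
  have "\<exists>c. (\<exists>m<n. c m \<noteq> 0) \<and> (\<Sum>m<n. scaleC (c m) (p m)) = 0"
  proof (cases "inj_on p {..<n}")
    case True
    have "p m \<in> cspan (h ` F)" for m
      unfolding p_def
      by (intro complex_vector.span_sum complex_vector.span_scale complex_vector.span_base imageI)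
    then have "p ` {..<n} \<subseteq> cspan (h ` F)" by blast
    moreover have "\<not> card (p ` {..<n}) \<le> card (h ` F)"
      using F(2) card_image_le[OF F(1), of h] by (simp add: card_image[OF True])
    ultimately have "complex_vector.dependent (p ` {..<n})"
      using complex_vector.independent_span_bound[of "h ` F" "p ` {..<n}"] F(1) by blast
    then obtain u where "\<exists>v\<in>p ` {..<n}. u v \<noteq> 0" "(\<Sum>v\<in>p ` {..<n}. scaleC (u v) v) = 0"
      using complex_vector.dependent_finite[of "p ` {..<n}"] by auto
    then show ?thesis
      by (intro exI[of _ "u \<circ> p"]) (auto simp: sum.reindex[OF True])
  \<comment> \<open>Dependence speaks of sets, so coinciding projections must be treated apart:
    their difference is the dependence.\<close>
  next
    case False
    then obtain a b where ab: "a < n" "b < n" "p a = p b" "a \<noteq> b" by (auto simp: inj_on_def)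
    have "(\<Sum>m<n. scaleC ((if m = a then 1 else 0) - (if m = b then 1 else 0)) (p m))
        = (\<Sum>m<n. if m = a then p a else 0) - (\<Sum>m<n. if m = b then p b else 0)"
      unfolding sum_subtractf[symmetric]
      by (rule sum.cong) (auto simp: complex_vector.scale_left_diff_distrib)
    also have "\<dots> = 0" using ab by simp
    finally show ?thesis
      using ab by (intro exI[of _ "\<lambda>m. (if m = a then 1 else 0) - (if m = b then 1 else 0)"])
        (auto intro!: exI[of _ a])
  qed
  then obtain c where c: "\<exists>m<n. c m \<noteq> 0" "(\<Sum>m<n. scaleC (c m) (p m)) = 0" by blast
  let ?x = "\<Sum>m<n. scaleC (c m) (e m)"
  have "(norm ?x)\<^sup>2 > 0"
    unfolding norm_orthonormal_sum[OF e finite_lessThan]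
    using c(1) by (auto intro: sum_pos2)
  moreover have "cinner (h j) ?x = 0" if "j \<in> F" for j
  proof -
    have "(\<Sum>m<n. scaleC (c m) (p m)) = (\<Sum>j\<in>F. scaleC (cinner (h j) ?x) (h j))"
      unfolding p_def complex_vector.scale_sum_right cinner_sum_right cinner_scaleC_right
        complex_vector.scale_sum_left
      by (subst sum.swap) simp
    then show ?thesis
      using cinner_orthonormal_sum[OF h F(1) that, of "\<lambda>j. cinner (h j) ?x"] c(2) by simp
  qed
  ultimately show thesis by (intro that[of c]) auto
qed

section \<open>Injectivity\<close>

text \<open>Supplies every explicit Phi below: the maps that spoil injectivity and the preimages in
  finite dimension.\<close>

lemma btc_elementary:
  fixes a b :: "'i \<Rightarrow> 'a::chilbert_space" and B :: "'i \<Rightarrow> 'b::chilbert_space \<Rightarrow> 'b"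
  assumes B: "\<And>i. i \<in> I \<Longrightarrow> trace_class (B i)"
  shows "restrict (\<lambda>A w. \<Sum>i\<in>I. scaleC (cinner (a i) (A (b i))) (B i w)) (Collect trace_class)
    \<in> bounded_trace_class_maps" (is "?\<Phi> \<in> _")
proof -
  have tc: "trace_class (\<lambda>w. \<Sum>i\<in>I. scaleC (cinner (a i) (A (b i))) (B i w))" for A
    using B by (intro trace_class_sum trace_class_scale)
  define K where "K = (\<Sum>i\<in>I. norm (a i) * norm (b i) * trace_norm (B i))"
  have "trace_norm (?\<Phi> A) \<le> K * trace_norm A" if A: "trace_class A" for A
  proof -
    have le: "cmod (cinner (a i) (A (b i))) * trace_norm (B i)
        \<le> norm (a i) * norm (b i) * trace_norm (B i) * trace_norm A" if "i \<in> I" for i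
    proof -
      have "cmod (cinner (a i) (A (b i))) \<le> norm (a i) * (trace_norm A * norm (b i))"
        by (rule order_trans[OF cmod_cinner_le mult_left_mono[OF norm_le_trace_norm[OF A]]]) simp
      from mult_right_mono[OF this trace_norm_nonneg[OF B[OF that]]] show ?thesis by (simp add: mult_ac)
    qed
    have "nuclear_bound (\<lambda>w. \<Sum>i\<in>I. scaleC (cinner (a i) (A (b i))) (B i w))
        (\<Sum>i\<in>I. cmod (cinner (a i) (A (b i))) * trace_norm (B i))"
      using B by (intro nuclear_bound_sum nuclear_bound_scale trace_class_nuclear_bound)
    then have "nuclear_bound (\<lambda>w. \<Sum>i\<in>I. scaleC (cinner (a i) (A (b i))) (B i w)) (K * trace_norm A)"
      unfolding K_def sum_distrib_right by (rule nuclear_bound_mono[OF _ sum_mono[OF le]])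
    then have "trace_norm (\<lambda>w. \<Sum>i\<in>I. scaleC (cinner (a i) (A (b i))) (B i w)) \<le> K * trace_norm A"
      by (rule nuclear_bound_trace_class(2)[OF trace_class_bounded_clinear[OF tc]])
    then show ?thesis using A by simp
  qed
  moreover have "?\<Phi> (\<lambda>x. A x + A' x) = (\<lambda>z. ?\<Phi> A z + ?\<Phi> A' z)" if "trace_class A" "trace_class A'" for A A'
    using that by (simp add: trace_class_add cinner_add_right scaleC_add_left sum.distrib)
  moreover have "?\<Phi> (\<lambda>x. scaleC c (A x)) = (\<lambda>z. scaleC c (?\<Phi> A z))" if "trace_class A" for c A
    using that by (simp add: trace_class_scale cinner_scaleC_right complex_vector.scale_sum_right)
  moreover have "?\<Phi> \<in> Collect trace_class \<rightarrow>\<^sub>E Collect trace_class"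
    using tc by auto
  ultimately show ?thesis unfolding bounded_trace_class_maps_def by blast
qed

context
  fixes tens :: "'h::chilbert_space \<Rightarrow> 'z::chilbert_space \<Rightarrow> 'k::chilbert_space"
  assumes tens: "hilbert_tensor tens"
begin

lemma inj_on_choi_map:
  fixes lam :: "'j \<Rightarrow> complex"
  assumes onb: "orthonormal_basis J g" and lam: "(\<lambda>j. norm (lam j)) summable_on J"
    and nz: "\<And>j. j \<in> J \<Longrightarrow> lam j \<noteq> 0"
  shows "inj_on (choi_map tens J lam g) bounded_trace_class_maps"
proof (rule inj_onI)
  fix \<Phi> \<Psi> assume \<Phi>: "\<Phi> \<in> bounded_trace_class_maps" and \<Psi>: "\<Psi> \<in> bounded_trace_class_maps"
    and eq: "choi_map tens J lam g \<Phi> = choi_map tens J lam g \<Psi>"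
  show "\<Phi> = \<Psi>"
  proof (rule btc_eqI[OF \<Phi> \<Psi> onb])
    fix j k assume jk: "j \<in> J" "k \<in> J"
    show "\<Phi> (ketbra (g j) (g k)) = \<Psi> (ketbra (g j) (g k))"
    proof (intro ext cinner_extI)
      fix w z
      show "cinner z (\<Phi> (ketbra (g j) (g k)) w) = cinner z (\<Psi> (ketbra (g j) (g k)) w)"
        using choi_map_matrix_entry[OF tens onb lam \<Phi> jk, of z w]
          choi_map_matrix_entry[OF tens onb lam \<Psi> jk, of z w] nz jk
        by (simp add: eq)
    qed
  qed
qed

text \<open>If lambda_j = 0, the (j, j) block is erased. The map A -> <g_j, A g_j> |z><z| lives on
  that block alone, so it has the same image as the zero map, here the elementary map over the empty
  index set.\<close>

lemma inj_on_choi_map_nonzero: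
  fixes lam :: "'j \<Rightarrow> complex" and z :: 'z
  assumes onb: "orthonormal_basis J g" and lam: "(\<lambda>j. norm (lam j)) summable_on J"
    and inj: "inj_on (choi_map tens J lam g) bounded_trace_class_maps" and z: "z \<noteq> 0"
    and j: "j \<in> J"
  shows "lam j \<noteq> 0"
proof
  assume lj: "lam j = 0"
  define \<Phi> :: "('h \<Rightarrow> 'h) \<Rightarrow> 'z \<Rightarrow> 'z" where
    "\<Phi> = restrict (\<lambda>A w. \<Sum>i\<in>{()}. scaleC (cinner (g j) (A (g j))) (ketbra z z w)) (Collect trace_class)"
  define \<Psi> :: "('h \<Rightarrow> 'h) \<Rightarrow> 'z \<Rightarrow> 'z" where
    "\<Psi> = restrict (\<lambda>A w. \<Sum>i\<in>({} :: unit set). scaleC (cinner (g j) (A (g j))) (ketbra z z w)) (Collect trace_class)"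
  have \<Phi>: "\<Phi> \<in> bounded_trace_class_maps" and \<Psi>: "\<Psi> \<in> bounded_trace_class_maps"
    unfolding \<Phi>_def \<Psi>_def by (rule btc_elementary, rule trace_class_ketbra)+
  have on: "cinner (g a) (g b) = (if a = b then 1 else 0)" if "a \<in> J" "b \<in> J" for a b
    using orthonormal_basis_orthonormal_on[OF onb] that by (simp add: orthonormal_on_def)
  have eq: "scaleC (cnj (lam a) * lam b) (tensor_op tens (ketbra (g a) (g b)) (\<Phi> (ketbra (g a) (g b))) v)
    = scaleC (cnj (lam a) * lam b) (tensor_op tens (ketbra (g a) (g b)) (\<Psi> (ketbra (g a) (g b))) v)"
    if "a \<in> J" "b \<in> J" for a b v
  proof (cases "a = j \<or> b = j")
    case False
    then have "\<Phi> (ketbra (g a) (g b)) = \<Psi> (ketbra (g a) (g b))"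
      using that j on by (simp add: \<Phi>_def \<Psi>_def trace_class_ketbra ketbra_def[of "g a"])
    then show ?thesis by simp
  qed (auto simp: lj)
  have "choi_map tens J lam g \<Phi> = choi_map tens J lam g \<Psi>"
  proof
    fix v
    have "((\<lambda>(a, b). scaleC (cnj (lam a) * lam b)
        (tensor_op tens (ketbra (g a) (g b)) (\<Psi> (ketbra (g a) (g b))) v))
        has_sum choi_map tens J lam g \<Phi> v) (J \<times> J)"
      using choi_map_has_sum[OF tens onb lam \<Phi>, of v]
      by (rule has_sum_cong[THEN iffD1, rotated]) (auto simp: eq)
    then show "choi_map tens J lam g \<Phi> v = choi_map tens J lam g \<Psi> v"
      using choi_map_has_sum[OF tens onb lam \<Psi>, of v] has_sum_unique by blast
  qed
  then have "\<Phi> = \<Psi>" using inj \<Phi> \<Psi> by (simp add: inj_on_def)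
  then have "\<Phi> (ketbra (g j) (g j)) z = \<Psi> (ketbra (g j) (g j)) z" by simp
  then show False
    using z on[OF j j] by (simp add: \<Phi>_def \<Psi>_def trace_class_ketbra) (simp add: ketbra_def)
qed

section \<open>Surjectivity\<close>

lemma choi_map_finite_surj:
  fixes lam :: "'j \<Rightarrow> complex" and T :: "'k \<Rightarrow> 'k"
  assumes onb: "orthonormal_basis J g" and J: "finite J" and nz: "\<And>j. j \<in> J \<Longrightarrow> lam j \<noteq> 0"
    and T: "trace_class T"
  obtains \<Phi> where "\<Phi> \<in> bounded_trace_class_maps" "choi_map tens J lam g \<Phi> = T"
proof -
  have lam: "(\<lambda>j. norm (lam j)) summable_on J" using J by simp
  note onJ = orthonormal_basis_orthonormal_on[OF onb]
  have on: "cinner (g a) (g b) = (if a = b then 1 else 0)" if "a \<in> J" "b \<in> J" for a b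
    using onJ that by (simp add: orthonormal_on_def)
  note bct = bounded_clinear_tens_right[OF tens]
  \<comment> \<open>The (j, k) block of T. Dividing it by cnj(lambda_j) lambda_k undoes the weights,
    and for finite J the resulting finite sum of elementary maps is automatically bounded.\<close>
  define C where "C j k w = cadjoint (tens (g j)) (T (tens (g k) w))" for j k w
  have C: "trace_class (C j k)" if "j \<in> J" "k \<in> J" for j k
  proof -
    have "bounded_clinear (C j k)"
      unfolding C_def
      by (intro bounded_clinear_compose[OF bounded_clinear_cadjoint[OF bct]]
          bounded_clinear_compose[OF trace_class_bounded_clinear[OF T]] bct)
    moreover have "nuclear_bound (C j k) (trace_norm T)"
      by (rule nuclear_bound_compress[OF trace_class_nuclear_bound[OF T], of "tens (g j)" "tens (g k)"])
         (use that orthonormal_on_norm[OF onJ] in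
           \<open>simp_all add: bct norm_tens[OF tens] C_def cinner_cadjoint_right[OF bct]\<close>)
    ultimately show ?thesis by (rule nuclear_bound_trace_class)
  qed
  define B where "B i w = scaleC (1 / (cnj (lam (fst i)) * lam (snd i))) (C (fst i) (snd i) w)" for i w
  define \<Phi> where "\<Phi> = restrict (\<lambda>A w. \<Sum>i\<in>J \<times> J. scaleC (cinner (g (fst i)) (A (g (snd i)))) (B i w))
    (Collect trace_class)"
  have \<Phi>: "\<Phi> \<in> bounded_trace_class_maps"
    unfolding \<Phi>_def B_def by (intro btc_elementary trace_class_scale C) auto
  have \<Phi>_ketbra: "\<Phi> (ketbra (g j) (g k)) w = B (j, k) w" if "j \<in> J" "k \<in> J" for j k w
  proof -
    have "cinner (g (fst i)) (ketbra (g j) (g k) (g (snd i))) = (if i = (j, k) then 1 else 0)"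
      if "i \<in> J \<times> J" for i
      using that \<open>j \<in> J\<close> \<open>k \<in> J\<close> by (cases i) (auto simp: on ketbra_def cinner_scaleC_right)
    then have "(\<Sum>i\<in>J \<times> J. scaleC (cinner (g (fst i)) (ketbra (g j) (g k) (g (snd i)))) (B i w))
        = (\<Sum>i\<in>J \<times> J. if i = (j, k) then B i w else 0)"
      by (intro sum.cong) auto
    then have "\<Phi> (ketbra (g j) (g k)) w = (\<Sum>i\<in>J \<times> J. if i = (j, k) then B i w else 0)"
      by (simp add: \<Phi>_def trace_class_ketbra)
    then show ?thesis using that J by simp
  qed
  let ?S = "{tens (g j) w | j w. j \<in> J}"
  have entry: "cinner u (choi_map tens J lam g \<Phi> v) = cinner u (T v)" if uv: "u \<in> ?S" "v \<in> ?S" for u v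
  proof -
    obtain j z k w where *: "j \<in> J" "u = tens (g j) z" "k \<in> J" "v = tens (g k) w" using uv by blast
    have "cinner u (choi_map tens J lam g \<Phi> v) = cnj (lam j) * lam k * cinner z (B (j, k) w)"
      unfolding * by (simp only: choi_map_matrix_entry[OF tens onb lam \<Phi> *(1,3)] \<Phi>_ketbra[OF *(1,3)])
    also have "\<dots> = cinner z (C j k w)"
      using nz * by (simp add: B_def cinner_scaleC_right)
    also have "\<dots> = cinner u (T v)"
      by (simp add: C_def * cinner_cadjoint_right[OF bct])
    finally show ?thesis .
  qed
  have "choi_map tens J lam g \<Phi> = T"
  proof (rule bounded_clinear_ext[OF tens_basis_dense[OF tens onb]])
    show "bounded_clinear (choi_map tens J lam g \<Phi>)" "bounded_clinear T"
      using T trace_class_choi_map[OF tens onb lam \<Phi>] by (auto intro: trace_class_bounded_clinear)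
    fix v assume v: "v \<in> ?S"
    let ?d = "choi_map tens J lam g \<Phi> v - T v"
    let ?V = "{u. cinner u ?d = 0}"
    have "complex_vector.subspace ?V"
      by (intro complex_vector.subspaceI) (auto simp: cinner_add_left cinner_scaleC_left)
    moreover have "closed ?V"
      by (intro closed_Collect_eq linear_continuous_on bounded_linear_cinner_left continuous_on_const)
    moreover have "?S \<subseteq> ?V" using entry[OF _ v] by (auto simp: cinner_diff_right)
    ultimately have "?d \<in> ?V" by (intro closed_subspace_eq_UNIV[OF tens_basis_dense[OF tens onb]])
    then show "choi_map tens J lam g \<Phi> v = T v" by simp
  qed
  with \<Phi> show thesis by (rule that)
qed

text \<open>For w = g_j \<otimes> z the operator |w><w| has a nonzero diagonal entry at w, while
  every operator in the image has entry 0 there when lambda_j = 0.\<close>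

lemma surj_choi_map_nonzero:
  fixes lam :: "'j \<Rightarrow> complex" and z :: 'z
  assumes onb: "orthonormal_basis J g" and lam: "(\<lambda>j. norm (lam j)) summable_on J"
    and surj: "Collect trace_class \<subseteq> choi_map tens J lam g ` bounded_trace_class_maps" and z: "z \<noteq> 0"
    and j: "j \<in> J"
  shows "lam j \<noteq> 0"
proof
  assume lj: "lam j = 0"
  let ?w = "tens (g j) z"
  obtain \<Phi> where \<Phi>: "\<Phi> \<in> bounded_trace_class_maps" "choi_map tens J lam g \<Phi> = ketbra ?w ?w"
    using surj trace_class_ketbra[of ?w ?w] by (metis imageE mem_Collect_eq subsetD)
  have "cinner ?w (ketbra ?w ?w ?w) = 0"
    using choi_map_matrix_entry[OF tens onb lam \<Phi>(1) j j, of z z] by (simp add: \<Phi>(2) lj)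
  then have "?w = 0" by (simp add: ketbra_def cinner_scaleC_right)
  then have "norm (g j) * norm z = 0" by (simp flip: norm_tens[OF tens])
  then show False
    using z orthonormal_on_norm[OF orthonormal_basis_orthonormal_on[OF onb] j] by simp
qed

text \<open>
  If \<open>T = C(\<Phi>)\<close> then \<open>\<langle>x \<otimes> z, T (x \<otimes> z)\<rangle>\<close> is at most \<open>K (L / n)\<^sup>2 \<parallel>x\<parallel>\<^sup>2\<close> for all \<open>x\<close> orthogonal to the
  fewer than \<open>n\<close> vectors \<open>g\<^sub>j\<close> with \<open>|\<lambda>\<^sub>j| > L / n\<close>, where \<open>L = \<parallel>\<lambda>\<parallel>\<^sub>1\<close>. Hence the \<open>n\<close>-th eigenvalue of such
  a \<open>T = \<Sum>\<^sub>n t\<^sub>n |e\<^sub>n \<otimes> z\<rangle>\<langle>e\<^sub>n \<otimes> z|\<close> is \<open>O(n\<^sup>-\<^sup>2)\<close>, whatever \<open>\<lambda>\<close> and \<open>g\<close>; this fails for \<open>t\<^sub>n = n\<^sup>-\<^sup>3\<^sup>/\<^sup>2\<close>.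
\<close>

lemma choi_map_eigenvalue_decay:
  fixes lam :: "'j \<Rightarrow> complex" and z :: 'z and e :: "nat \<Rightarrow> 'h"
  assumes onb: "orthonormal_basis J g" and lam: "(\<lambda>j. norm (lam j)) summable_on J"
    and \<Phi>: "\<Phi> \<in> bounded_trace_class_maps" and z: "norm z = 1"
    and e: "orthonormal_on UNIV e"
    and lower: "\<And>n c. t n * (norm (\<Sum>m\<le>n. scaleC (c m) (e m)))\<^sup>2
      \<le> cmod (cinner (tens (\<Sum>m\<le>n. scaleC (c m) (e m)) z)
          (choi_map tens J lam g \<Phi> (tens (\<Sum>m\<le>n. scaleC (c m) (e m)) z)))"
  obtains C where "\<And>n. t n \<le> C / (real (Suc n))\<^sup>2"
proof -
  note onJ = orthonormal_basis_orthonormal_on[OF onb]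
  obtain K where K: "K \<ge> 0" "\<And>A. trace_class A \<Longrightarrow> trace_norm (\<Phi> A) \<le> K * trace_norm A"
    using bounded_trace_class_mapsE[OF \<Phi>] by blast
  define L where "L = infsum (\<lambda>j. cmod (lam j)) J"
  have "L \<ge> 0" unfolding L_def by (simp add: infsum_nonneg)
  have "t n \<le> K * L\<^sup>2 / (real (Suc n))\<^sup>2" for n
  proof -
    let ?N = "Suc n"
    define F where "F = {j \<in> J. cmod (lam j) > L / real ?N}"
    \<comment> \<open>Markov's inequality. The strict threshold in \<open>F\<close> yields fewer
      than n + 1 indices, which leaves a nonzero direction in the span of the n + 1 vectors e_0,
      ..., e_n.\<close>
    have small: "card G < ?N" if G: "finite G" "G \<subseteq> F" for G
    proof (cases "G = {}")
      case False
      have "real (card G) * (L / real ?N) < (\<Sum>j\<in>G. cmod (lam j))"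
        unfolding sum_constant[symmetric] using G False by (intro sum_strict_mono) (auto simp: F_def)
      also have "\<dots> \<le> L"
        unfolding L_def using G by (intro finite_sum_le_infsum lam) (auto simp: F_def)
      finally have *: "real (card G) * L < L * real ?N" by (simp add: field_simps)
      then have "L > 0" using \<open>L \<ge> 0\<close> by (cases "L = 0") auto
      then show ?thesis using * by (simp add: mult.commute)
    qed simp
    have F: "finite F"
      using finite_if_finite_subsets_card_bdd[of F ?N] small less_imp_le by blast
    have eN: "orthonormal_on {..<?N} e" and gF: "orthonormal_on F g"
      using orthonormal_on_subset[OF e] orthonormal_on_subset[OF onJ] by (auto simp: F_def)
    obtain c where c: "(\<Sum>m<?N. scaleC (c m) (e m)) \<noteq> 0"
      "\<And>j. j \<in> F \<Longrightarrow> cinner (g j) (\<Sum>m<?N. scaleC (c m) (e m)) = 0"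
      using orthogonal_combination_exists[OF eN gF F small[OF F order_refl]] by blast
    define x where "x = (\<Sum>m\<le>n. scaleC (c m) (e m))"
    have x: "x \<noteq> 0" "\<And>j. j \<in> F \<Longrightarrow> cinner (g j) x = 0"
      using c by (simp_all add: x_def lessThan_Suc_atMost)
    have "t n * (norm x)\<^sup>2 \<le> cmod (cinner (tens x z) (choi_map tens J lam g \<Phi> (tens x z)))"
      unfolding x_def by (rule lower)
    also have "\<dots> \<le> K * (L / real ?N * norm x)\<^sup>2 * (norm z)\<^sup>2"
    proof (rule choi_map_quadratic_le[OF tens onb lam \<Phi> K])
      show "0 \<le> L / real ?N" using \<open>L \<ge> 0\<close> by simp
      show "cmod (lam j) * cmod (cinner (g j) x) \<le> L / real ?N * cmod (cinner (g j) x)" if "j \<in> J" for j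
      proof (cases "j \<in> F")
        case False
        then have "cmod (lam j) \<le> L / real ?N" using that by (simp add: F_def)
        then show ?thesis by (rule mult_right_mono) simp
      qed (simp add: x(2))
    qed
    also have "\<dots> = K * L\<^sup>2 / (real ?N)\<^sup>2 * (norm x)\<^sup>2"
      by (simp add: z power_mult_distrib power_divide)
    finally show ?thesis using x(1) by (simp only: mult_le_cancel_right) simp
  qed
  then show thesis by (rule that)
qed

lemma universal_counterexample:
  fixes z :: 'z
  assumes inf: "\<not> cfinite_dim TYPE('h)" and z: "z \<noteq> 0"
  obtains T :: "'k \<Rightarrow> 'k" where "positive_op T" "trace_class T"
    "\<And>(J :: 'j set) g lam \<Phi>. orthonormal_basis J g \<Longrightarrow> (\<lambda>j. norm (lam j)) summable_on J \<Longrightarrow>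
       \<Phi> \<in> bounded_trace_class_maps \<Longrightarrow> choi_map tens J lam g \<Phi> \<noteq> T"
proof -
  have "infinite (some_basis :: 'h set)"
    using finite_basis_cfinite_dim[OF some_basis_orthonormal_basis] inf by blast
  then obtain e :: "nat \<Rightarrow> 'h" where e: "inj e" "range e \<subseteq> some_basis"
    using infinite_countable_subset by blast
  have on: "orthonormal_on UNIV e"
    using orthonormal_on_reindex[OF orthonormal_basis_orthonormal_on[OF some_basis_orthonormal_basis] e] .
  define y where "y = (1 / norm z) *\<^sub>R z"
  have y: "norm y = 1" using z by (simp add: y_def)
  define w where "w n = tens (e n) y" for n
  \<comment> \<open>The exponent lies strictly between 1, needed for summability, and 2, the decay
    forced on the image.\<close>
  define t :: "nat \<Rightarrow> real" where "t n = real (Suc n) powr (- 3 / 2)" for n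
  have t: "t n \<ge> 0" for n by (simp add: t_def)
  have "summable t"
    unfolding t_def summable_Suc_iff[of "\<lambda>n. real n powr (- 3 / 2)"] by (simp add: summable_real_powr_iff)
  then have tsum: "t summable_on UNIV" using t by (simp add: summable_on_UNIV_nonneg_real_iff)
  define A where "A = (\<lambda>n v. scaleC (complex_of_real (t n)) (ketbra (w n) (w n) v))"
  have A: "bounded_clinear (A n)" "nuclear_bound (A n) (t n)" for n
  proof -
    show "bounded_clinear (A n)"
      unfolding A_def by (intro bounded_clinear_scale bounded_clinear_ketbra)
    have "norm (w n) = 1"
      using orthonormal_on_norm[OF on, of n] by (simp add: w_def norm_tens[OF tens] y)
    then show "nuclear_bound (A n) (t n)"
      using nuclear_bound_scale[OF nuclear_bound_ketbra[of "w n" "w n"], of "complex_of_real (t n)"] t[of n]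
      by (simp add: A_def)
  qed
  obtain T where T: "\<And>v. ((\<lambda>n. A n v) has_sum T v) UNIV" and hT: "has_trace_norm_sum A T UNIV"
    using nuclear_summable[OF A tsum] by blast
  then have tcT: "trace_class T" by (simp add: has_trace_norm_sum_def)
  have Tv: "((\<lambda>n. complex_of_real (t n * (cmod (cinner (w n) v))\<^sup>2)) has_sum cinner v (T v)) UNIV" for v
  proof -
    have "cinner v (A n v) = complex_of_real (t n * (cmod (cinner (w n) v))\<^sup>2)" for n
      by (simp add: A_def ketbra_def cinner_scaleC_right cinner_commute[of v] complex_norm_square del: of_real_power)
    then show ?thesis
      using has_sum_bounded_linear[OF bounded_linear_cinner_right T, of v v] by (simp only: comp_def)
  qed
  have ReT: "((\<lambda>n. t n * (cmod (cinner (w n) v))\<^sup>2) has_sum Re (cinner v (T v))) UNIV" for v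
    using has_sum_Re[OF Tv[of v]] by simp
  have pos: "positive_op T"
    unfolding positive_op_def
  proof (intro conjI allI)
    show "bounded_clinear T" by (rule trace_class_bounded_clinear[OF tcT])
    fix v
    have "Re (cinner v (T v)) \<ge> 0" using t by (intro has_sum_nonneg[OF ReT[of v]]) simp
    moreover have "Im (cinner v (T v)) = 0"
      using has_sum_Im[OF Tv[of v]] has_sum_unique[OF _ has_sum_0_simp] by auto
    ultimately show "cinner v (T v) \<in> \<real>\<^sub>\<ge>\<^sub>0" by (simp add: complex_nonneg_Reals_iff)
  qed
  have "choi_map tens J lam g \<Phi> \<noteq> T"
    if onb: "orthonormal_basis J g" and lam: "(\<lambda>j. norm (lam j)) summable_on J"
      and \<Phi>: "\<Phi> \<in> bounded_trace_class_maps" for J :: "'j set" and g lam \<Phi>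
  proof
    assume eq: "choi_map tens J lam g \<Phi> = T"
    have "t n * (norm (\<Sum>m\<le>n. scaleC (c m) (e m)))\<^sup>2
      \<le> cmod (cinner (tens (\<Sum>m\<le>n. scaleC (c m) (e m)) y) (T (tens (\<Sum>m\<le>n. scaleC (c m) (e m)) y)))" for n c
    proof -
      let ?x = "\<Sum>m\<le>n. scaleC (c m) (e m)"
      have on': "orthonormal_on {..n} e" using orthonormal_on_subset[OF on] by blast
      have wx: "cinner (w m) (tens ?x y) = c m" if "m \<le> n" for m
        using cinner_orthonormal_sum[OF on', of m c] that
        by (simp add: w_def cinner_tens[OF tens] cinner_same y)
      have "t n * (norm ?x)\<^sup>2 = (\<Sum>m\<le>n. t n * (cmod (c m))\<^sup>2)"
        by (simp add: norm_orthonormal_sum[OF on'] sum_distrib_left)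
      \<comment> \<open>The weights decrease, so t_n is the smallest of t_0, ..., t_n.\<close>
      also have "\<dots> \<le> (\<Sum>m\<le>n. t m * (cmod (cinner (w m) (tens ?x y)))\<^sup>2)"
        by (intro sum_mono) (auto simp: wx t_def intro!: mult_right_mono powr_mono2')
      also have "\<dots> \<le> Re (cinner (tens ?x y) (T (tens ?x y)))"
        using t by (intro finite_sum_le_has_sum[OF ReT]) auto
      also have "\<dots> \<le> cmod (cinner (tens ?x y) (T (tens ?x y)))" by (rule complex_Re_le_cmod)
      finally show ?thesis .
    qed
    then obtain C where C: "\<And>n. t n \<le> C / (real (Suc n))\<^sup>2"
      using choi_map_eigenvalue_decay[OF onb lam \<Phi> y on, of t] unfolding eq by blast
    \<comment> \<open>Since 2 - 3/2 = 1/2, decay of order n^-2 would make sqrt n bounded.\<close>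
    have "sqrt (real (Suc n)) \<le> C" for n
    proof -
      have "sqrt (real (Suc n)) = real (Suc n) powr (2 + - 3 / 2)"
        by (simp add: powr_half_sqrt)
      also have "\<dots> = (real (Suc n))\<^sup>2 * t n"
        unfolding t_def by (subst powr_add) (simp add: powr_numeral)
      also have "\<dots> \<le> C" using C[of n] by (simp add: field_simps)
      finally show ?thesis .
    qed
    moreover obtain n where "C\<^sup>2 < real n" using reals_Archimedean2 by blast
    then have "C < sqrt (real (Suc n))" by (intro real_less_rsqrt) simp
    ultimately show False by (meson not_less)
  qed
  with pos tcT show thesis by (rule that)
qed

end

text \<open>The nonzero vector excludes the zero space for 'z. There the set of maps and the set of
  trace-class operators on 'k would be singletons, and the map would be bijective for every
  lambda.\<close>

theorem proposition3p1:
  fixes tens :: "'h::chilbert_space \<Rightarrow> 'z::chilbert_space \<Rightarrow> 'k::chilbert_space"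
  assumes "hilbert_tensor tens"
    and "\<exists>z::'z. z \<noteq> 0"
  shows "(\<forall>(J::'j set) (g::'j \<Rightarrow> 'h) (lam::'j \<Rightarrow> complex).
            orthonormal_basis J g \<and> (\<lambda>j. norm (lam j)) summable_on J \<longrightarrow>
              (inj_on (choi_map tens J lam g) bounded_trace_class_maps \<longleftrightarrow>
                 separable_space (euclidean :: 'h topology) \<and> (\<forall>j\<in>J. lam j \<noteq> 0)) \<and>
              (choi_map tens J lam g ` bounded_trace_class_maps = Collect trace_class \<longleftrightarrow>
                 cfinite_dim TYPE('h) \<and> (\<forall>j\<in>J. lam j \<noteq> 0))) \<and>
         (\<not> cfinite_dim TYPE('h) \<longrightarrow>
            (\<exists>T::'k \<Rightarrow> 'k. positive_op T \<and> trace_class T \<and>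
               (\<forall>(J::'j set) (g::'j \<Rightarrow> 'h) (lam::'j \<Rightarrow> complex).
                  orthonormal_basis J g \<and> (\<lambda>j. norm (lam j)) summable_on J \<longrightarrow>
                  {\<Phi> \<in> bounded_trace_class_maps. choi_map tens J lam g \<Phi> = T} = {})))"
proof -
  note tens = assms(1)
  obtain z :: 'z where z: "z \<noteq> 0" using assms(2) by blast
  \<comment> \<open>Proved ahead of the equivalences because the only-if direction of the
    surjectivity criterion also draws on it.\<close>
  have universal: "\<exists>T::'k \<Rightarrow> 'k. positive_op T \<and> trace_class T \<and>
      (\<forall>(J::'j set) (g::'j \<Rightarrow> 'h) (lam::'j \<Rightarrow> complex).
        orthonormal_basis J g \<and> (\<lambda>j. norm (lam j)) summable_on J \<longrightarrow>
        {\<Phi> \<in> bounded_trace_class_maps. choi_map tens J lam g \<Phi> = T} = {})"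
    if inf: "\<not> cfinite_dim TYPE('h)"
  proof -
    obtain T :: "'k \<Rightarrow> 'k" where "positive_op T" "trace_class T"
      "\<And>(J :: 'j set) g lam \<Phi>. orthonormal_basis J g \<Longrightarrow> (\<lambda>j. norm (lam j)) summable_on J \<Longrightarrow>
         \<Phi> \<in> bounded_trace_class_maps \<Longrightarrow> choi_map tens J lam g \<Phi> \<noteq> T"
      using universal_counterexample[OF tens inf z, where 'j = 'j] by blast
    then show ?thesis by (intro exI[of _ T]) blast
  qed
  moreover have "(inj_on (choi_map tens J lam g) bounded_trace_class_maps \<longleftrightarrow>
        separable_space (euclidean :: 'h topology) \<and> (\<forall>j\<in>J. lam j \<noteq> 0)) \<and>
      (choi_map tens J lam g ` bounded_trace_class_maps = Collect trace_class \<longleftrightarrow>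
        cfinite_dim TYPE('h) \<and> (\<forall>j\<in>J. lam j \<noteq> 0))"
    if onb: "orthonormal_basis J g" and lam: "(\<lambda>j. norm (lam j)) summable_on J"
    for J :: "'j set" and g :: "'j \<Rightarrow> 'h" and lam
  proof (intro conjI iffI)
    assume inj: "inj_on (choi_map tens J lam g) bounded_trace_class_maps"
    show nz: "\<forall>j\<in>J. lam j \<noteq> 0"
      using inj_on_choi_map_nonzero[OF tens onb lam inj z] by blast
    have "{j \<in> J. norm (lam j) \<noteq> 0} = J" using nz by auto
    then have "countable J" using summable_countable_real[OF lam] by simp
    then show "separable_space (euclidean :: 'h topology)"
      by (intro separable_space_cspan[OF _ orthonormal_basis_dense[OF onb]]) simp
  next
    assume "separable_space (euclidean :: 'h topology) \<and> (\<forall>j\<in>J. lam j \<noteq> 0)"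
    then show "inj_on (choi_map tens J lam g) bounded_trace_class_maps"
      by (intro inj_on_choi_map[OF tens onb lam]) blast
  next
    assume surj: "choi_map tens J lam g ` bounded_trace_class_maps = Collect trace_class"
    show "\<forall>j\<in>J. lam j \<noteq> 0"
      using surj_choi_map_nonzero[OF tens onb lam _ z] surj by blast
    show "cfinite_dim TYPE('h)"
    proof (rule ccontr)
      assume "\<not> cfinite_dim TYPE('h)"
      from universal[OF this] obtain T :: "'k \<Rightarrow> 'k" where "trace_class T"
        and T: "\<forall>(J::'j set) (g::'j \<Rightarrow> 'h) (lam::'j \<Rightarrow> complex).
          orthonormal_basis J g \<and> (\<lambda>j. norm (lam j)) summable_on J \<longrightarrow>
          {\<Phi> \<in> bounded_trace_class_maps. choi_map tens J lam g \<Phi> = T} = {}"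
        by (elim exE conjE)
      have "T \<in> choi_map tens J lam g ` bounded_trace_class_maps"
        using \<open>trace_class T\<close> by (simp add: surj)
      then obtain \<Phi> where "\<Phi> \<in> bounded_trace_class_maps" "T = choi_map tens J lam g \<Phi>" by (rule imageE)
      moreover have "{\<Phi> \<in> bounded_trace_class_maps. choi_map tens J lam g \<Phi> = T} = {}"
        using T[rule_format, OF conjI, OF onb lam] .
      ultimately show False by blast
    qed
  next
    assume fin: "cfinite_dim TYPE('h) \<and> (\<forall>j\<in>J. lam j \<noteq> 0)"
    then have J: "finite J"
      using cfinite_dim_finite_basis orthonormal_basis_orthonormal_on[OF onb] by blast
    show "choi_map tens J lam g ` bounded_trace_class_maps = Collect trace_class"
    proof
      show "choi_map tens J lam g ` bounded_trace_class_maps \<subseteq> Collect trace_class"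
        using trace_class_choi_map[OF tens onb lam] by blast
      show "Collect trace_class \<subseteq> choi_map tens J lam g ` bounded_trace_class_maps"
      proof
        fix T :: "'k \<Rightarrow> 'k" assume "T \<in> Collect trace_class"
        then obtain \<Phi> where "\<Phi> \<in> bounded_trace_class_maps" "choi_map tens J lam g \<Phi> = T"
          using choi_map_finite_surj[OF tens onb J, of lam T] fin by blast
        then show "T \<in> choi_map tens J lam g ` bounded_trace_class_maps" by blast
      qed
    qed
  qed
  ultimately show ?thesis by blast
qed

end
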